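(* Let $k$ be a field of characteristic $0$, let $n\geq 2$, and let $X=\operatorname{Spec} k[y]/(y^n)\subset\mathbb{A}^1_k$ be the $n$-fold point. Let $J_\infty^0(X)$ be the focussed arc algebra of $X$ at the origin, graded by weight. Then its Hilbert-Poincaré series is $$\operatorname{HP}_{J_\infty^0(X)}(t)=\mathbb{H}\cdot\prod_{\substack{i\geq 1\\ i\equiv 0,n,n+1 \bmod 2n+1}}(1-t^i),\qquad \text{where } \mathbb{H}=\prod_{i\geq 1}\frac{1}{1-t^i}.$$ Equivalently, $$\operatorname{HP}_{J_\infty^0(X)}(t)=\prod_{\substack{i\geq 1\\ i\not\equiv 0,n,n+1 \bmod 2n+1}}\frac{1}{1-t^i}.$$
   Context: The focussed arc algebra at the origin of $X=\{y^n=0\}\subset\mathbb{A}^1_k$ is $J_\infty^0(X)=k[y_1,y_2,\ldots]/(f_1,f_2,\ldots)$, where $k[y_1,y_2,\ldots]$ is the polynomial ring in countably many variables and $f_\ell$ is the coefficient of $t^\ell$ in $(y_1t+y_2t^2+y_3t^3+\cdots)^n$. The ring $k[y_1,y_2,\ldots]$ is graded by giving $y_i$ weight $i$; each $f_\ell$ is homogeneous of weight $\ell$, so $J_\infty^0(X)$ is graded. For a graded $k$-algebra $A=\bigoplus_{j\geq 0}A_j$ with finite-dimensional pieces, $\operatorname{HP}_A(t)=\sum_{j\geq 0}\dim_k(A_j)\,t^j\in\mathbb{Z}[[t]]$. *)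

theory Defs
  imports
    "HOL-Analysis.Infinite_Products"
    "HOL-Computational_Algebra.Formal_Power_Series"
    "HOL-Library.Poly_Mapping"
    "HOL-Algebra.Embedded_Algebras"
    "HOL-Algebra.QuotRing"
    "HOL-Algebra.Algebraic_Closure_Type"
begin

text \<open>
  The polynomial ring \<open>k[y\<^sub>1, y\<^sub>2, \<dots>]\<close> as a monoid algebra. Exponent vectors are indexed from 0,
  so index \<open>i\<close> belongs to the variable \<open>y\<close> with subscript \<open>i + 1\<close>, of weight \<open>i + 1\<close>.
\<close>

type_synonym 'k arc_poly = "(nat \<Rightarrow>\<^sub>0 nat) \<Rightarrow>\<^sub>0 'k"

definition arc_var :: "nat \<Rightarrow> 'k::comm_ring_1 arc_poly"
  where "arc_var i = Poly_Mapping.single (Poly_Mapping.single (i - 1) 1) 1"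

definition arc_const :: "'k::comm_ring_1 \<Rightarrow> 'k arc_poly"
  where "arc_const c = Poly_Mapping.single 0 c"

definition arc_weight :: "(nat \<Rightarrow>\<^sub>0 nat) \<Rightarrow> nat"
  where "arc_weight m = (\<Sum>i\<in>Poly_Mapping.keys m. Suc i * Poly_Mapping.lookup m i)"

definition weight_piece :: "nat \<Rightarrow> 'k::comm_ring_1 arc_poly set"
  where "weight_piece j = {p. \<forall>m\<in>Poly_Mapping.keys p. arc_weight m = j}"

definition generic_arc :: "'k::comm_ring_1 arc_poly fps"
  where "generic_arc = Abs_fps (\<lambda>i. if i = 0 then 0 else arc_var i)"

definition arc_eqn :: "nat \<Rightarrow> nat \<Rightarrow> 'k::comm_ring_1 arc_poly"
  where "arc_eqn n l = (generic_arc ^ n) $ l"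

definition arc_ideal :: "nat \<Rightarrow> 'k::comm_ring_1 arc_poly set"
  where "arc_ideal n = Idl\<^bsub>ring_of_type_algebra\<^esub> {arc_eqn n l | l. l \<ge> 1}"

definition arc_class :: "nat \<Rightarrow> 'k::comm_ring_1 arc_poly \<Rightarrow> 'k arc_poly set"
  where "arc_class n p = arc_ideal n +>\<^bsub>ring_of_type_algebra\<^esub> p"

definition focussed_arc_algebra :: "nat \<Rightarrow> 'k::comm_ring_1 arc_poly set ring"
  where "focussed_arc_algebra n = ring_of_type_algebra Quot arc_ideal n"

definition arc_scalars :: "nat \<Rightarrow> 'k::comm_ring_1 arc_poly set set"
  where "arc_scalars n = arc_class n ` range arc_const"

definition arc_piece :: "nat \<Rightarrow> nat \<Rightarrow> 'k::comm_ring_1 arc_poly set set"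
  where "arc_piece n j = arc_class n ` weight_piece j"

text \<open>
  \<open>K\<close> is the copy of the base field inside \<open>A\<close>, and \<open>piece j\<close> the \<open>j\<close>-th graded piece of \<open>A\<close>.
\<close>

definition hilbert_poincare :: "('a, 'b) ring_scheme \<Rightarrow> 'a set \<Rightarrow> (nat \<Rightarrow> 'a set) \<Rightarrow> int fps"
  where "hilbert_poincare A K piece = Abs_fps (\<lambda>j. int (ring.dim A K (piece j)))"

text \<open>
  \<open>1/(1 - t\<^sup>i)\<close> for \<open>i \<ge> 1\<close>. The type \<open>int fps\<close> has no \<open>inverse\<close>, as \<open>int\<close> has none; the second
  argument of \<^term>\<open>fps_right_inverse\<close> is the inverse of the constant coefficient.
\<close>

definition inv_one_minus_X_power :: "nat \<Rightarrow> int fps"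
  where "inv_one_minus_X_power i = fps_right_inverse (1 - fps_X ^ i) 1"

lemma inv_one_minus_X_power:
  assumes "i \<ge> 1"
  shows "(1 - fps_X ^ i) * inv_one_minus_X_power i = 1"
  unfolding inv_one_minus_X_power_def using assms by (intro fps_right_inverse) auto

text \<open>All infinite products in the theorem converge in the \<open>t\<close>-adic topology.\<close>

lemma convergent_prod_fps_int:
  fixes f :: "nat \<Rightarrow> int fps"
  assumes "f 0 = 1" and unit: "\<And>i. f i $ 0 = 1" and small: "\<And>i m. 0 < m \<Longrightarrow> m < i \<Longrightarrow> f i $ m = 0"
  shows "convergent_prod f"
proof -
  have nz: "f k \<noteq> 0" for k
    using unit[of k] by auto
  have sub: "f k \<noteq> 1 \<Longrightarrow> subdegree (f k - 1) \<ge> k" for k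
  proof (rule subdegree_geI)
    show "f k \<noteq> 1 \<Longrightarrow> f k - 1 \<noteq> 0" by simp
    show "(f k - 1) $ i = 0" if "i < k" for i
      using that unit[of k] small[of i k] by (cases "i = 0") auto
  qed
  have lim: "\<exists>P. (\<lambda>n. \<Prod>k\<le>n. f k) \<longlonglongrightarrow> P"
  proof -
    have "\<exists>P. \<forall>n. eventually (\<lambda>N. (\<Prod>k\<le>N. f k) $ n = P n) sequentially"
    proof (intro exI allI)
      fix n
      have step: "(\<Prod>k\<le>N. f k) $ n = (\<Prod>k\<le>n. f k) $ n" if "N \<ge> n" for N
        using that
      proof (induction N rule: dec_induct)
        case (step N)
        have "(f (Suc N) * (\<Prod>k\<le>N. f k)) $ n = (\<Sum>i=0..n. f (Suc N) $ i * (\<Prod>k\<le>N. f k) $ (n - i))"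
          by (simp add: fps_mult_nth)
        also have "\<dots> = (\<Sum>i=0..n. if i = 0 then (\<Prod>k\<le>N. f k) $ n else 0)"
          using step by (intro sum.cong) (auto simp: unit small)
        finally show ?case
          using step by (simp add: mult.commute)
      qed simp
      show "eventually (\<lambda>N. (\<Prod>k\<le>N. f k) $ n = (\<Prod>k\<le>n. f k) $ n) sequentially"
        using eventually_ge_at_top[of n] by eventually_elim (rule step)
    qed
    then obtain P where "\<forall>n. eventually (\<lambda>N. (\<Prod>k\<le>N. f k) $ n = P n) sequentially" by blast
    then have "(\<lambda>N. \<Prod>k\<le>N. f k) \<longlonglongrightarrow> Abs_fps P"
      by (intro tendsto_fpsI) simp
    then show ?thesis by blast
  qed
  then obtain P where P: "(\<lambda>n. \<Prod>k\<le>n. f k) \<longlonglongrightarrow> P" by blast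
  have "(\<Prod>k\<le>N. f k) $ 0 = 1" for N
    by (induction N) (auto simp: unit)
  moreover have "eventually (\<lambda>N. (\<Prod>k\<le>N. f k) $ 0 = P $ 0) sequentially"
    using P unfolding tendsto_fps_iff by blast
  ultimately have "P $ 0 = 1" by simp
  then have "P \<noteq> 0" by auto
  with P show ?thesis
    unfolding convergent_prod_def raw_has_prod_def by (intro exI[of _ 0] exI[of _ P]) simp
qed

lemma inv_one_minus_X_power_nth:
  assumes "i \<ge> 1" "m < i"
  shows "inv_one_minus_X_power i $ m = (if m = 0 then 1 else 0)"
proof -
  have "(inv_one_minus_X_power i - fps_X ^ i * inv_one_minus_X_power i) $ m = 1 $ m"
    using inv_one_minus_X_power[OF assms(1)] by (simp only: left_diff_distrib mult_1_left)
  then show ?thesis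
    using assms by (simp add: fps_X_power_mult_nth)
qed

lemma convergent_prod_inv_one_minus_X_power:
  "convergent_prod (\<lambda>i. if i \<ge> 1 \<and> Q i then inv_one_minus_X_power i else 1)"
  by (rule convergent_prod_fps_int) (auto simp: inv_one_minus_X_power_nth)

lemma convergent_prod_one_minus_X_power:
  "convergent_prod (\<lambda>i. if i \<ge> 1 \<and> Q i then 1 - fps_X ^ i else (1 :: int fps))"
  by (rule convergent_prod_fps_int) (auto simp: fps_X_power_nth)


text \<open>
  The scalars form a subfield of the algebra and every graded piece has finite dimension over it,
  so \<^term>\<open>ring.dim\<close> takes its intended value in \<^term>\<open>hilbert_poincare\<close>.
\<close>

lemma ideal_arc_ideal: "ideal (arc_ideal n :: 'k::comm_ring_1 arc_poly set) ring_of_type_algebra"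
proof -
  interpret P: ring "ring_of_type_algebra :: 'k arc_poly ring" by (rule ring_from_type_algebra)
  show ?thesis
    unfolding arc_ideal_def by (rule P.genideal_ideal) (simp add: ring_of_type_algebra_def)
qed

lemma arc_class_ring_hom:
  "ring_hom_ring ring_of_type_algebra (focussed_arc_algebra n)
     (arc_class n :: 'k::comm_ring_1 arc_poly \<Rightarrow> _)"
proof -
  have "arc_class n = (+>\<^bsub>ring_of_type_algebra\<^esub>) (arc_ideal n :: 'k arc_poly set)"
    by (simp add: arc_class_def fun_eq_iff)
  then show ?thesis
    unfolding focussed_arc_algebra_def using ideal.rcos_ring_hom_ring[OF ideal_arc_ideal] by simp
qed

lemma lookup_mult_0:
  fixes p q :: "'k::comm_ring_1 arc_poly"
  shows "Poly_Mapping.lookup (p * q) 0 = Poly_Mapping.lookup p 0 * Poly_Mapping.lookup q 0"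
proof -
  have eq: "0 = l + m \<longleftrightarrow> l = 0 \<and> m = 0" for l m :: "nat \<Rightarrow>\<^sub>0 nat"
    by (auto simp: poly_mapping_eq_iff fun_eq_iff lookup_add)
  have "(\<Sum>m. Poly_Mapping.lookup q m when 0 = l + m) = (Poly_Mapping.lookup q 0 when l = 0)" for l
    unfolding eq by (cases "l = 0") simp_all
  then show ?thesis
    by (simp add: lookup_mult mult_when)
qed

lemma lookup_arc_eqn_0:
  assumes "n \<ge> 1"
  shows "Poly_Mapping.lookup (arc_eqn n l :: 'k::comm_ring_1 arc_poly) 0 = 0"
proof -
  have *: "Poly_Mapping.lookup ((generic_arc :: 'k arc_poly fps) $ i) 0 = 0" for i
    by (auto simp: generic_arc_def arc_var_def lookup_single when_def poly_mapping_eq_iff fun_eq_iff)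
  obtain m where "n = Suc m" using assms by (cases n) auto
  then show ?thesis
    by (simp add: arc_eqn_def fps_mult_nth lookup_sum lookup_mult_0 *)
qed

lemma one_notin_arc_ideal:
  assumes "n \<ge> 1"
  shows "(1 :: 'k::comm_ring_1 arc_poly) \<notin> arc_ideal n"
proof
  let ?J = "{p :: 'k arc_poly. Poly_Mapping.lookup p 0 = 0}"
  interpret P: ring "ring_of_type_algebra :: 'k arc_poly ring" by (rule ring_from_type_algebra)
  have inv: "\<ominus>\<^bsub>ring_of_type_algebra\<^esub> p = - p" for p :: "'k arc_poly"
    by (rule P.minus_equality) (auto simp: ring_of_type_algebra_def)
  have "ideal ?J ring_of_type_algebra"
  proof (rule idealI)
    show "subgroup ?J (add_monoid ring_of_type_algebra)"
      using inv by (intro P.add.subgroupI)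
        (auto simp: ring_of_type_algebra_def lookup_add a_inv_def intro!: exI[of _ 0])
  qed (fact P.ring_axioms, auto simp: ring_of_type_algebra_def lookup_mult_0)
  moreover have "{arc_eqn n l | l. l \<ge> 1} \<subseteq> ?J"
    using lookup_arc_eqn_0[OF assms] by auto
  moreover assume "1 \<in> (arc_ideal n :: 'k arc_poly set)"
  ultimately have "1 \<in> ?J" unfolding arc_ideal_def genideal_def by blast
  then show False by (simp add: lookup_one)
qed

lemma subfield_arc_scalars:
  assumes "n \<ge> 1"
  shows "subfield (arc_scalars n) (focussed_arc_algebra n :: 'k::field arc_poly set ring)"
proof -
  let ?A = "focussed_arc_algebra n :: 'k arc_poly set ring"
  interpret k: field "ring_of_type_algebra :: 'k ring" by (rule field_from_type_algebra)
  interpret P: ring "ring_of_type_algebra :: 'k arc_poly ring" by (rule ring_from_type_algebra)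
  interpret h: ring_hom_ring "ring_of_type_algebra :: 'k arc_poly ring" ?A "arc_class n"
    by (rule arc_class_ring_hom)
  interpret I: ideal "arc_ideal n" "ring_of_type_algebra :: 'k arc_poly ring"
    by (rule ideal_arc_ideal)
  have "ring_hom_ring (ring_of_type_algebra :: 'k ring) ?A (arc_class n \<circ> arc_const)"
  proof (rule ring_hom_ringI2)
    have "arc_const \<in> ring_hom (ring_of_type_algebra :: 'k ring) (ring_of_type_algebra :: 'k arc_poly ring)"
      by (rule ring_hom_memI)
        (auto simp: ring_of_type_algebra_def arc_const_def mult_single single_add)
    then show "arc_class n \<circ> arc_const \<in> ring_hom (ring_of_type_algebra :: 'k ring) ?A"
      using h.homh by (rule ring_hom_trans)
  qed unfold_locales
  moreover have "\<one>\<^bsub>?A\<^esub> \<noteq> \<zero>\<^bsub>?A\<^esub>"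
  proof
    assume "\<one>\<^bsub>?A\<^esub> = \<zero>\<^bsub>?A\<^esub>"
    then have "arc_ideal n +>\<^bsub>ring_of_type_algebra\<^esub> (1 :: 'k arc_poly) = arc_ideal n"
      by (simp add: focussed_arc_algebra_def FactRing_def) (simp add: ring_of_type_algebra_def)
    then have "(1 :: 'k arc_poly) \<in> arc_ideal n"
      using I.a_rcos_self[of 1] by (simp add: ring_of_type_algebra_def)
    then show False using one_notin_arc_ideal[OF assms] by blast
  qed
  ultimately have "subfield ((arc_class n \<circ> arc_const) ` carrier ring_of_type_algebra) ?A"
    using ring_hom_ring.img_is_subfield(2) k.carrier_is_subfield by blast
  then show ?thesis
    by (simp add: arc_scalars_def image_comp ring_of_type_algebra_def)
qed

lemma finite_arc_weight: "finite {m. arc_weight m = j}"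
proof -
  let ?F = "{f :: nat \<Rightarrow> nat. \<forall>i. (i \<in> {..j} \<longrightarrow> f i \<in> {..j}) \<and> (i \<notin> {..j} \<longrightarrow> f i = 0)}"
  have mem: "Poly_Mapping.lookup m \<in> ?F" if "arc_weight m = j" for m
  proof -
    have le: "Suc i * Poly_Mapping.lookup m i \<le> j" for i
    proof (cases "i \<in> Poly_Mapping.keys m")
      case True
      then show ?thesis
        using member_le_sum[of i "Poly_Mapping.keys m" "\<lambda>i. Suc i * Poly_Mapping.lookup m i"] that
        by (simp add: arc_weight_def)
    next
      case False
      then show ?thesis by (simp add: in_keys_iff)
    qed
    have "Poly_Mapping.lookup m i \<le> j" for i
    proof -
      have "1 * Poly_Mapping.lookup m i \<le> Suc i * Poly_Mapping.lookup m i" by (rule mult_le_mono1) simp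
      with le[of i] show ?thesis by linarith
    qed
    moreover have "Poly_Mapping.lookup m i = 0" if "i > j" for i
    proof (rule ccontr)
      assume "Poly_Mapping.lookup m i \<noteq> 0"
      then have "1 \<le> Poly_Mapping.lookup m i" by linarith
      then have "Suc i * 1 \<le> Suc i * Poly_Mapping.lookup m i" by (rule mult_le_mono2)
      from order_trans[OF this le[of i]] that show False by simp
    qed
    ultimately show ?thesis by simp
  qed
  have "Poly_Mapping.lookup ` {m. arc_weight m = j} \<subseteq> ?F"
    by (rule image_subsetI) (rule mem, erule CollectD)
  moreover have "finite ?F" by (rule finite_set_of_finite_funs) auto
  ultimately have *: "finite (Poly_Mapping.lookup ` {m. arc_weight m = j})" by (rule finite_subset)
  show ?thesis
    by (rule finite_imageD[OF *]) (simp add: inj_on_def lookup_inject)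
qed

lemma finite_dimension_arc_piece:
  assumes "n \<ge> 1"
  shows "ring.finite_dimension (focussed_arc_algebra n :: 'k::field arc_poly set ring)
           (arc_scalars n) (arc_piece n j)"
proof -
  let ?R = "ring_of_type_algebra :: 'k arc_poly ring"
  let ?A = "focussed_arc_algebra n :: 'k arc_poly set ring"
  let ?K = "arc_scalars n :: 'k arc_poly set set"
  let ?c = "arc_class n :: 'k arc_poly \<Rightarrow> _"
  let ?mon = "\<lambda>m. Poly_Mapping.single m (1 :: 'k)"
  interpret h: ring_hom_ring ?R ?A ?c by (rule arc_class_ring_hom)
  note K = subfield_arc_scalars[OF assms, where 'k = 'k]
  have c_add: "?c (p + q) = ?c p \<oplus>\<^bsub>?A\<^esub> ?c q" for p q
    using h.hom_add[of p q] by (simp add: ring_of_type_algebra_def)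
  have c_mult: "?c (p * q) = ?c p \<otimes>\<^bsub>?A\<^esub> ?c q" for p q
    using h.hom_mult[of p q] by (simp add: ring_of_type_algebra_def)
  have c_0: "?c 0 = \<zero>\<^bsub>?A\<^esub>"
    using h.hom_zero by (simp add: ring_of_type_algebra_def)
  have c_car: "?c p \<in> carrier ?A" for p
    using h.hom_closed[of p] by (simp add: ring_of_type_algebra_def)
  have neg: "\<ominus>\<^bsub>?A\<^esub> ?c p = ?c (- p)" for p
    by (rule h.S.minus_equality) (simp_all add: c_car c_add[symmetric] c_0)
  obtain ms where ms: "set ms = {m. arc_weight m = j}"
    using finite_list[OF finite_arc_weight] by blast
  let ?Us = "map (\<lambda>m. ?c (?mon m)) ms"
  have Us: "set ?Us \<subseteq> carrier ?A" using c_car by auto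
  note props = h.S.Span_subgroup_props[OF K Us]
  have term_in: "?c (Poly_Mapping.single m a) \<in> ring.Span ?A ?K ?Us" if "arc_weight m = j" for m a
  proof -
    have "?c (Poly_Mapping.single m a) = ?c (arc_const a) \<otimes>\<^bsub>?A\<^esub> ?c (?mon m)"
      by (simp add: c_mult[symmetric] arc_const_def mult_single)
    moreover have "?c (?mon m) \<in> ring.Span ?A ?K ?Us"
      using h.S.Span_base_incl[OF K Us] that ms by auto
    ultimately show ?thesis
      using h.S.Span_smult_closed[OF K Us, of "?c (arc_const a)"] by (simp add: arc_scalars_def)
  qed
  have sum_in: "?c (\<Sum>m\<in>S. Poly_Mapping.single m (a m)) \<in> ring.Span ?A ?K ?Us"
    if "finite S" "S \<subseteq> {m. arc_weight m = j}" for S a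
    using that
  proof (induction S rule: finite_induct)
    case empty
    then show ?case using props(2) c_0 by simp
  next
    case (insert m S)
    have "?c (Poly_Mapping.single m (a m)) \<oplus>\<^bsub>?A\<^esub> ?c (\<Sum>m\<in>S. Poly_Mapping.single m (a m))
            \<in> ring.Span ?A ?K ?Us"
      by (rule props(3)) (use insert term_in in auto)
    then show ?case using insert by (simp add: c_add)
  qed
  have incl: "arc_piece n j \<subseteq> ring.Span ?A ?K ?Us"
  proof
    fix x :: "'k arc_poly set"
    assume "x \<in> arc_piece n j"
    then obtain p where p: "x = ?c p" "p \<in> weight_piece j" by (auto simp: arc_piece_def)
    have "p = (\<Sum>m\<in>Poly_Mapping.keys p. Poly_Mapping.single m (Poly_Mapping.lookup p m))"
      by (rule poly_mapping_eqI)
        (auto simp: lookup_sum lookup_single when_def in_keys_iff)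
    moreover have "Poly_Mapping.keys p \<subseteq> {m. arc_weight m = j}"
      using p(2) by (auto simp: weight_piece_def)
    ultimately show "x \<in> ring.Span ?A ?K ?Us"
      using sum_in[of "Poly_Mapping.keys p" "Poly_Mapping.lookup p"] p(1) by simp
  qed
  have "subalgebra ?K (arc_piece n j) ?A"
  proof (intro subalgebra.intro subalgebra_axioms.intro h.S.add.subgroupI)
    show "arc_piece n j \<subseteq> carrier ?A"
      using c_car by (auto simp: arc_piece_def)
    show "(arc_piece n j :: 'k arc_poly set set) \<noteq> {}"
      by (auto simp: arc_piece_def weight_piece_def intro!: exI[of _ 0])
    show "\<ominus>\<^bsub>?A\<^esub> x \<in> arc_piece n j" if "x \<in> arc_piece n j" for x
      using that neg by (auto simp: arc_piece_def weight_piece_def)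
    show "x \<oplus>\<^bsub>?A\<^esub> y \<in> arc_piece n j" if "x \<in> arc_piece n j" "y \<in> arc_piece n j" for x y
    proof -
      obtain p q where "x = ?c p" "p \<in> weight_piece j" "y = ?c q" "q \<in> weight_piece j"
        using \<open>x \<in> arc_piece n j\<close> \<open>y \<in> arc_piece n j\<close> unfolding arc_piece_def by blast
      moreover from this have "p + q \<in> weight_piece j"
        using keys_add[of p q] by (auto simp: weight_piece_def)
      ultimately show ?thesis
        unfolding arc_piece_def by (simp only: c_add[symmetric]) (rule imageI)
    qed
    show "k \<otimes>\<^bsub>?A\<^esub> v \<in> arc_piece n j" if "k \<in> ?K" "v \<in> arc_piece n j" for k v
    proof -
      obtain a p where "k = ?c (arc_const a)" "v = ?c p" "p \<in> weight_piece j"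
        using \<open>k \<in> ?K\<close> \<open>v \<in> arc_piece n j\<close> unfolding arc_piece_def arc_scalars_def by blast
      moreover have "arc_const a * p \<in> weight_piece j"
        unfolding weight_piece_def
      proof (intro CollectI ballI)
        fix m assume "m \<in> Poly_Mapping.keys (arc_const a * p)"
        then obtain l q where "m = l + q" "l \<in> Poly_Mapping.keys (arc_const a)" "q \<in> Poly_Mapping.keys p"
          using keys_mult[of "arc_const a" p] by blast
        then have "m \<in> Poly_Mapping.keys p"
          by (simp add: arc_const_def split: if_splits)
        then show "arc_weight m = j"
          using \<open>p \<in> weight_piece j\<close> unfolding weight_piece_def by blast
      qed
      ultimately show ?thesis
        unfolding arc_piece_def by (simp only: c_mult[symmetric]) (rule imageI)
    qed
  qed
  then show ?thesis
    using h.S.subalbegra_incl_imp_finite_dimension[OF K h.S.Span_finite_dimension[OF K Us]] incl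
    by blast
qed

end

theory Submission
  imports Defs "HOL-Combinatorics.Permutations"
begin

text \<open>
  Call a monomial standard if, for all \<open>i\<close>, its exponents at \<open>y\<^sub>i\<close> and \<open>y\<^bsub>i+1\<^esub>\<close> sum to less than \<open>n\<close>.
  The standard monomials form a basis of the arc algebra.

  They span: among the monomials of \<open>f\<^sub>l\<close> the most balanced one, \<open>y\<^sub>i\<^sup>a y\<^bsub>i+1\<^esub>\<^sup>b\<close> with \<open>a + b = n\<close>, is the
  unique minimum of \<open>Q = \<Sum> i\<^sup>2 \<nu>\<^sub>i\<close>, so every nonstandard monomial reduces to monomials with larger \<open>Q\<close>.

  They are independent: let \<open>y\<^sub>i\<close> act as \<open>\<partial>/\<partial>Y\<^sub>i\<close>. The series \<open>y(x)\<close> then acts as the derivation that adds to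
  a matrix \<open>(Y\<^bsub>s i + t j\<^esub>)\<close> the rank one matrix \<open>(x\<^bsup>s i\<^esup> x\<^bsup>t j\<^esup>)\<close>, so its square kills the determinant and its
  \<open>n\<close>-th power kills a product of \<open>n - 1\<close> such determinants. Hence each such product is a functional on the
  arc algebra. Any standard monomial occurs as the product of the diagonals of suitable determinants, and
  by the rearrangement inequality all other terms of the expansion have smaller \<open>Q\<close>: the functionals are
  triangular with respect to the standard monomials.

  Standard monomials are counted by Gordon's identity. Their generating functions, refined by the least
  allowed variable and its exponent, satisfy a recursion that is also solved by an alternating sum, which
  at the boundary is evaluated by Jacobi's triple product.
\<close>

section \<open>Power series with integer coefficients\<close>

no_notation vec_nth (infixl "$" 90)

lemma fps_X_power_dvd_iff:
  fixes f :: "'a::comm_ring_1 fps"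
  shows "fps_X ^ W dvd f \<longleftrightarrow> (\<forall>i<W. f $ i = 0)"
proof
  assume "\<forall>i<W. f $ i = 0"
  then have "f = fps_X ^ W * fps_shift W f"
    by (intro fps_ext) (simp add: fps_X_power_mult_nth)
  then show "fps_X ^ W dvd f" by (rule dvdI)
qed (auto simp: fps_X_power_mult_nth elim!: dvdE)

text \<open>Congruence modulo t^W. Identities between infinite products are proved modulo every t^W,
  where each product can be replaced by a finite one; \<open>fps_cong_eqI\<close> recovers
  equality.\<close>

definition fps_cong :: "nat \<Rightarrow> int fps \<Rightarrow> int fps \<Rightarrow> bool"
  where "fps_cong W f g \<longleftrightarrow> fps_X ^ W dvd f - g"

lemma fps_cong_iff: "fps_cong W f g \<longleftrightarrow> (\<forall>i<W. f $ i = g $ i)"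
  by (simp add: fps_cong_def fps_X_power_dvd_iff)

lemma fps_cong_refl [simp]: "fps_cong W f f"
  by (simp add: fps_cong_iff)

lemma fps_cong_sym: "fps_cong W f g \<Longrightarrow> fps_cong W g f"
  by (simp add: fps_cong_iff)

lemma fps_cong_trans [trans]: "fps_cong W f g \<Longrightarrow> fps_cong W g h \<Longrightarrow> fps_cong W f h"
  by (simp add: fps_cong_iff)

lemma fps_cong_add: "fps_cong W f g \<Longrightarrow> fps_cong W f' g' \<Longrightarrow> fps_cong W (f + f') (g + g')"
  by (simp add: fps_cong_iff)

lemma fps_cong_mult:
  assumes "fps_cong W f g" "fps_cong W f' g'"
  shows "fps_cong W (f * f') (g * g')"
  using assms unfolding fps_cong_iff fps_mult_nth by (auto intro!: sum.cong)

lemma fps_cong_sum: "(\<And>i. i \<in> A \<Longrightarrow> fps_cong W (f i) (g i)) \<Longrightarrow> fps_cong W (sum f A) (sum g A)"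
  by (simp add: fps_cong_iff fps_sum_nth)

lemma fps_cong_prod: "(\<And>i. i \<in> A \<Longrightarrow> fps_cong W (f i) (g i)) \<Longrightarrow> fps_cong W (prod f A) (prod g A)"
  by (induction A rule: infinite_finite_induct) (auto intro: fps_cong_mult)

lemma fps_cong_eqI: "(\<And>W. fps_cong W f g) \<Longrightarrow> f = g"
  unfolding fps_cong_iff by (intro fps_ext) blast

lemma fps_cong_monom_0: "W \<le> e \<Longrightarrow> fps_cong W (fps_X ^ e * f) 0"
  by (simp add: fps_cong_iff fps_X_power_mult_nth)

text \<open>Constant coefficient 1 makes \<open>h\<close> a unit of \<open>int fps\<close>, with
  inverse \<open>fps_right_inverse h 1\<close>.\<close>

lemma fps_cong_cancel:
  assumes "h $ 0 = 1" "fps_cong W (h * f) (h * g)"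
  shows "fps_cong W f g"
proof -
  have inv: "fps_right_inverse h 1 * h = 1"
    using fps_right_inverse[of h 1] assms(1) by (simp add: mult.commute)
  have "fps_cong W (fps_right_inverse h 1 * (h * f)) (fps_right_inverse h 1 * (h * g))"
    by (intro fps_cong_mult assms fps_cong_refl)
  then show ?thesis by (simp add: mult.assoc[symmetric] inv)
qed

lemma fps_cong_prod_mono:
  assumes "finite B" "A \<subseteq> B" "\<And>i. i \<in> B - A \<Longrightarrow> fps_cong W (f i) 1"
  shows "fps_cong W (prod f B) (prod f A)"
proof -
  have "fps_cong W (prod f (B - A)) 1"
    using fps_cong_prod[of "B - A" W f "\<lambda>_. 1"] assms(3) by simp
  from fps_cong_mult[OF this fps_cong_refl[of W "prod f A"]] show ?thesis
    using prod.subset_diff[OF assms(2,1), of f] by simp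
qed

text \<open>A factor of index at least W is 1 modulo t^W and may be dropped. The
  \<open>max 1 i\<close> forces constant coefficient 1 also for the factor of index 0, where a
  congruence modulo t^0 would say nothing.\<close>

lemma prodinf_fps_cong:
  assumes f: "\<And>i. fps_cong (max 1 i) (f i) 1"
    and A: "finite A" "{..<W} \<subseteq> A"
  shows "fps_cong W (prodinf f) (prod f A)"
proof -
  have tail: "fps_cong W (f i) 1" if "W \<le> i" for i W
    using f[of i] that by (simp add: fps_cong_iff)
  have nz: "f i \<noteq> 0" for i
    using f[of i, unfolded fps_cong_iff, rule_format, of 0] by (auto simp: less_max_iff_disj)
  \<comment> \<open>Coefficient m is stable from the m-th partial product on, so the limit is read
    off along the diagonal.\<close>
  define P where "P = Abs_fps (\<lambda>m. (\<Prod>k\<le>m. f k) $ m)"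
  have nth_P: "(\<Prod>k\<le>N. f k) $ m = P $ m" if "m \<le> N" for m N
  proof -
    have "fps_cong (Suc m) (prod f {..N}) (prod f {..m})"
      using that by (intro fps_cong_prod_mono tail) auto
    then show ?thesis by (simp add: fps_cong_iff P_def)
  qed
  have lim: "(\<lambda>N. \<Prod>k\<le>N. f k) \<longlonglongrightarrow> P"
  proof (rule tendsto_fpsI)
    fix m show "eventually (\<lambda>N. (\<Prod>k\<le>N. f k) $ m = P $ m) sequentially"
      using eventually_ge_at_top[of m] by eventually_elim (rule nth_P)
  qed
  have "P $ 0 = 1"
    using f[of 0] by (simp add: P_def fps_cong_iff)
  then have has: "raw_has_prod f 0 P"
    using lim by (auto simp: raw_has_prod_def)
  have uniq: "p = P" if "raw_has_prod f 0 p" for p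
    using that lim LIMSEQ_unique by (auto simp: raw_has_prod_def)
  \<comment> \<open>No factor vanishes, which rules out the clause of \<open>has_prod\<close> for
    products with zero factors.\<close>
  have "f has_prod p \<longleftrightarrow> raw_has_prod f 0 p" for p
    by (simp add: has_prod_def nz)
  then have "prodinf f = P"
    unfolding prodinf_def using has uniq by (intro the_equality) blast+
  moreover have "fps_cong W (prod f A) (prod f {..W})"
  proof -
    have "fps_cong W (prod f A) (prod f {..<W})" "fps_cong W (prod f {..W}) (prod f {..<W})"
      using A by (intro fps_cong_prod_mono tail; auto)+
    then show ?thesis by (simp add: fps_cong_iff)
  qed
  ultimately show ?thesis using nth_P by (simp add: fps_cong_iff)
qed

lemma fps_cong_one_minus_X_power: "W \<le> i \<Longrightarrow> fps_cong W (1 - fps_X ^ i) 1"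
  by (simp add: fps_cong_iff fps_X_power_nth)

lemma fps_cong_inv_one_minus_X_power:
  "W \<le> i \<Longrightarrow> 1 \<le> i \<Longrightarrow> fps_cong W (inv_one_minus_X_power i) 1"
  by (simp add: fps_cong_iff inv_one_minus_X_power_nth)

lemma prodinf_fps_mult:
  assumes f: "\<And>i. fps_cong (max 1 i) (f i) 1" and g: "\<And>i. fps_cong (max 1 i) (g i) 1"
  shows "prodinf f * prodinf g = prodinf (\<lambda>i. f i * g i)"
proof (rule fps_cong_eqI)
  fix W
  have fg: "fps_cong (max 1 i) (f i * g i) 1" for i
    using fps_cong_mult[OF f[of i] g[of i]] by simp
  have "fps_cong W (prodinf f * prodinf g) (prod f {..<W} * prod g {..<W})"
    by (intro fps_cong_mult prodinf_fps_cong f g) auto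
  also have "fps_cong W \<dots> (prodinf (\<lambda>i. f i * g i))"
    unfolding prod.distrib[symmetric] by (intro fps_cong_sym[OF prodinf_fps_cong] fg) auto
  finally show "fps_cong W (prodinf f * prodinf g) (prodinf (\<lambda>i. f i * g i))" .
qed

definition euler_fps :: "int fps"
  where "euler_fps = prodinf (\<lambda>i. if i \<ge> 1 then 1 - fps_X ^ i else 1)"

lemma euler_fps_cong:
  assumes "W \<le> Suc N"
  shows "fps_cong W euler_fps (\<Prod>r=1..N. 1 - fps_X ^ r)"
proof -
  let ?f = "\<lambda>i. if i \<ge> 1 then 1 - fps_X ^ i else (1 :: int fps)"
  have "fps_cong W (prodinf ?f) (prod ?f {..N})"
    using assms by (intro prodinf_fps_cong) (auto simp: fps_cong_one_minus_X_power)
  also have "prod ?f {..N} = (\<Prod>r=1..N. 1 - fps_X ^ r)"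
    by (intro prod.mono_neutral_cong_right) auto
  finally show ?thesis by (simp add: euler_fps_def)
qed

section \<open>The Jacobi triple product\<close>

text \<open>The Gaussian binomial coefficient of a + b over a, indexed by its two complementary
  parts and defined by a q-Pascal rule, so that no division occurs.\<close>

fun gauss_binom :: "'a::comm_ring_1 \<Rightarrow> nat \<Rightarrow> nat \<Rightarrow> 'a" where
  "gauss_binom Q 0 b = 1"
| "gauss_binom Q (Suc a) 0 = 1"
| "gauss_binom Q (Suc a) (Suc b) = Q ^ Suc a * gauss_binom Q (Suc a) b + gauss_binom Q a (Suc b)"

lemma gauss_binom_0 [simp]: "gauss_binom Q a 0 = 1"
  by (cases a) auto

text \<open>The induction rests on 1 - Q^(a+b+2) = Q^(a+1) (1 - Q^(b+1)) + (1 - Q^(a+1)).\<close>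

lemma gauss_binom_fact:
  "gauss_binom Q a b * (\<Prod>r=1..a. 1 - Q ^ r) * (\<Prod>r=1..b. 1 - Q ^ r) = (\<Prod>r=1..a+b. 1 - Q ^ r)"
proof (induction Q a b rule: gauss_binom.induct)
  case (3 Q a b)
  have "gauss_binom Q (Suc a) (Suc b) * (\<Prod>r=1..Suc a. 1 - Q ^ r) * (\<Prod>r=1..Suc b. 1 - Q ^ r)
     = Q ^ Suc a * (1 - Q ^ Suc b) * (gauss_binom Q (Suc a) b * (\<Prod>r=1..Suc a. 1 - Q ^ r) * (\<Prod>r=1..b. 1 - Q ^ r))
     + (1 - Q ^ Suc a) * (gauss_binom Q a (Suc b) * (\<Prod>r=1..a. 1 - Q ^ r) * (\<Prod>r=1..Suc b. 1 - Q ^ r))"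
    by (simp add: algebra_simps)
  also have "\<dots> = Q ^ Suc a * (1 - Q ^ Suc b) * (\<Prod>r=1..Suc a + b. 1 - Q ^ r)
     + (1 - Q ^ Suc a) * (\<Prod>r=1..Suc a + b. 1 - Q ^ r)"
    by (simp only: 3) simp
  also have "\<dots> = (\<Prod>r=1..Suc a + Suc b. 1 - Q ^ r)"
    by (simp add: algebra_simps power_add)
  finally show ?case .
qed simp_all

text \<open>Splitting off the factor j = 0 leaves the product for N with v replaced by v Q.
  Multiplying its expansion by u + v, the two contributions to each power of v combine by the
  q-Pascal rule.\<close>

lemma gauss_binomial_theorem:
  "(\<Prod>j<N. u + v * Q ^ j) = (\<Sum>k\<le>N. gauss_binom Q k (N - k) * Q ^ (k choose 2) * v ^ k * u ^ (N - k))"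
proof -
  have choose_0: "0 choose 2 = (0::nat)"
    by (rule binomial_eq_0) simp
  show ?thesis
  proof (induction N arbitrary: v)
    case (Suc N)
    let ?t = "\<lambda>N k. gauss_binom Q k (N - k) * Q ^ (k choose 2) * v ^ k * u ^ (N - k)"
    have choose: "Suc k choose 2 = (k choose 2) + k" for k
      by (simp add: numeral_2_eq_2)
    have "(\<Prod>j<Suc N. u + v * Q ^ j) = (u + v) * (\<Prod>j<N. u + (v * Q) * Q ^ j)"
      by (simp only: prod.lessThan_Suc_shift power_Suc mult.assoc) simp
    also have "\<dots> = u * (\<Sum>k\<le>N. gauss_binom Q k (N - k) * Q ^ (k choose 2) * (v * Q) ^ k * u ^ (N - k))
       + v * (\<Sum>k\<le>N. gauss_binom Q k (N - k) * Q ^ (k choose 2) * (v * Q) ^ k * u ^ (N - k))"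
      by (simp add: Suc distrib_right)
    also have "v * (\<Sum>k\<le>N. gauss_binom Q k (N - k) * Q ^ (k choose 2) * (v * Q) ^ k * u ^ (N - k))
       = (\<Sum>k\<le>N. gauss_binom Q k (N - k) * Q ^ (Suc k choose 2) * v ^ Suc k * u ^ (N - k))"
      by (simp add: sum_distrib_left power_mult_distrib power_add choose algebra_simps)
    also have "u * (\<Sum>k\<le>N. gauss_binom Q k (N - k) * Q ^ (k choose 2) * (v * Q) ^ k * u ^ (N - k))
       = u ^ Suc N + (\<Sum>k<N. Q ^ Suc k * gauss_binom Q (Suc k) (N - Suc k) * Q ^ (Suc k choose 2) * v ^ Suc k * u ^ (N - k))"
      unfolding lessThan_Suc_atMost[symmetric] sum.lessThan_Suc_shift distrib_left sum_distrib_left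
    proof (intro arg_cong2[of _ _ _ _ "(+)"] sum.cong refl)
      fix k assume "k \<in> {..<N}"
      then have "N - k = Suc (N - Suc k)" by simp
      then show "u * (gauss_binom Q (Suc k) (N - Suc k) * Q ^ (Suc k choose 2) * (v * Q) ^ Suc k * u ^ (N - Suc k))
          = Q ^ Suc k * gauss_binom Q (Suc k) (N - Suc k) * Q ^ (Suc k choose 2) * v ^ Suc k * u ^ (N - k)"
        by (simp only: power_mult_distrib power_Suc mult_ac)
    qed (simp add: choose_0)
    also have "u ^ Suc N + (\<Sum>k<N. Q ^ Suc k * gauss_binom Q (Suc k) (N - Suc k) * Q ^ (Suc k choose 2) * v ^ Suc k * u ^ (N - k))
       + (\<Sum>k\<le>N. gauss_binom Q k (N - k) * Q ^ (Suc k choose 2) * v ^ Suc k * u ^ (N - k))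
       = u ^ Suc N + (\<Sum>k<N. (Q ^ Suc k * gauss_binom Q (Suc k) (N - Suc k) + gauss_binom Q k (N - k))
            * Q ^ (Suc k choose 2) * v ^ Suc k * u ^ (N - k)) + ?t (Suc N) (Suc N)"
      by (simp only: lessThan_Suc_atMost[symmetric] sum.lessThan_Suc) (simp add: sum.distrib distrib_right)
    also have "(\<Sum>k<N. (Q ^ Suc k * gauss_binom Q (Suc k) (N - Suc k) + gauss_binom Q k (N - k))
            * Q ^ (Suc k choose 2) * v ^ Suc k * u ^ (N - k)) = (\<Sum>k<N. ?t (Suc N) (Suc k))"
    proof (rule sum.cong[OF refl])
      fix k assume "k \<in> {..<N}"
      then obtain d where "N - k = Suc d" "N - Suc k = d" by (cases "N - k") auto
      then show "(Q ^ Suc k * gauss_binom Q (Suc k) (N - Suc k) + gauss_binom Q k (N - k))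
            * Q ^ (Suc k choose 2) * v ^ Suc k * u ^ (N - k) = ?t (Suc N) (Suc k)"
        by simp
    qed
    also have "u ^ Suc N + (\<Sum>k<N. ?t (Suc N) (Suc k)) + ?t (Suc N) (Suc N) = (\<Sum>k\<le>Suc N. ?t (Suc N) k)"
      by (simp only: lessThan_Suc_atMost[symmetric] sum.lessThan_Suc_shift[of _ "Suc N"] sum.lessThan_Suc[of _ N])
        (simp add: choose_0)
    finally show ?case .
  next
    case 0
    show ?case by (simp add: choose_0)
  qed
qed

lemma choose_2_add: "(a + b) choose 2 = (a choose 2) + (b choose 2) + a * b"
  by (induction b) (simp_all add: numeral_2_eq_2)

lemma square_eq_choose_2: "p * p = 2 * (p choose 2) + p"
  by (induction p) (simp_all add: numeral_2_eq_2)

lemma prod_lessThan_add: 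
  fixes f :: "nat \<Rightarrow> 'a::comm_monoid_mult"
  shows "(\<Prod>j<a + b. f j) = (\<Prod>j<a. f j) * (\<Prod>j<b. f (a + j))"
  by (induction b) (simp_all add: mult_ac)

lemma sum_lessThan_add: 
  fixes f :: "nat \<Rightarrow> 'a::comm_monoid_add"
  shows "(\<Sum>j<a + b. f j) = (\<Sum>j<a. f j) + (\<Sum>j<b. f (a + j))"
  by (induction b) (simp_all add: add_ac)

text \<open>The q-binomial theorem for 2L factors with Q = t^M, u = Q^L and v = -t^n. Taking u = Q^L
  instead of 1 keeps all exponents natural; the resulting common factor \<open>C\<close> is
  cancelled at the end. The summation index is centred at L: k = L - p gives the first sum, k = L +
  p + 1 the second.\<close>

lemma finite_jacobi_triple_product:
  fixes n L :: nat and M :: nat and g :: "nat \<Rightarrow> nat \<Rightarrow> int fps"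
  defines "M \<equiv> 2 * n + 1"
  defines "g \<equiv> gauss_binom (fps_X ^ M)"
  shows "(\<Prod>j<L. (1 - fps_X ^ (M * j + n)) * (1 - fps_X ^ (M * j + n + 1))) =
    (\<Sum>p\<le>L. (- 1) ^ p * fps_X ^ (n * p\<^sup>2 + (Suc p choose 2)) * g (L - p) (L + p)) -
    (\<Sum>p<L. (- 1) ^ p * fps_X ^ (n * p\<^sup>2 + (Suc p choose 2) + (2 * p + 1) * n) * g (L + p + 1) (L - p - 1))"
proof -
  define Q where "Q = (fps_X :: int fps) ^ M"
  define u where "u = Q ^ L"
  define v where "v = - ((fps_X :: int fps) ^ n)"
  define C :: "int fps" where "C = (- 1) ^ L * fps_X ^ (M * (L choose 2) + n * L + M * (L * L))"
  define t where "t k = g k (2 * L - k) * Q ^ (k choose 2) * v ^ k * u ^ (2 * L - k)" for k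
  have v_pow: "v ^ k = (- 1) ^ k * fps_X ^ (n * k)" for k
    by (simp add: v_def power_minus[of "fps_X ^ n"] flip: power_mult)
  have c1: "(\<Prod>j<l. - (fps_X ^ n * Q ^ j)) = (- 1) ^ l * fps_X ^ (M * (l choose 2) + n * l)" for l
    by (induction l) (simp_all add: binomial_eq_0 numeral_2_eq_2 Q_def algebra_simps flip: power_add power_mult)
  \<comment> \<open>In the lower half the summand v Q^j has the smaller exponent and is pulled out.
    Reversing the order of the factors and using Q^(j+1) = t^n t^(M j + n + 1) turns the rest into
    the class of n + 1.\<close>
  have "(\<Prod>j<L. u + v * Q ^ j) = (\<Prod>j<L. (- (fps_X ^ n * Q ^ (L - Suc j))) * (1 - fps_X ^ (M * j + n + 1)))"
    unfolding prod.nat_diff_reindex[of "\<lambda>j. u + v * Q ^ j", symmetric]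
  proof (rule prod.cong[OF refl])
    fix j assume "j \<in> {..<L}"
    then have "L = (L - Suc j) + Suc j" by simp
    then have "u = Q ^ (L - Suc j) * Q ^ Suc j"
      unfolding u_def by (metis power_add)
    moreover have "Q ^ Suc j = fps_X ^ n * fps_X ^ (M * j + n + 1)"
      by (simp add: Q_def M_def algebra_simps flip: power_add power_mult power_Suc)
    ultimately show "u + v * Q ^ (L - Suc j) = - (fps_X ^ n * Q ^ (L - Suc j)) * (1 - fps_X ^ (M * j + n + 1))"
      by (simp add: v_def algebra_simps)
  qed
  also have "\<dots> = (\<Prod>j<L. - (fps_X ^ n * Q ^ j)) * (\<Prod>j<L. 1 - fps_X ^ (M * j + n + 1))"
    by (simp only: prod.distrib prod.nat_diff_reindex[of "\<lambda>j. - (fps_X ^ n * Q ^ j)"])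
  finally have low: "(\<Prod>j<L. u + v * Q ^ j) = (- 1) ^ L * fps_X ^ (M * (L choose 2) + n * L) * (\<Prod>j<L. 1 - fps_X ^ (M * j + n + 1))"
    by (simp only: c1)
  have "u + v * Q ^ (L + j) = Q ^ L * (1 - fps_X ^ (M * j + n))" for j
    by (simp add: u_def v_def Q_def power_add algebra_simps flip: power_mult)
  then have high: "(\<Prod>j<L. u + v * Q ^ (L + j)) = fps_X ^ (M * (L * L)) * (\<Prod>j<L. 1 - fps_X ^ (M * j + n))"
    by (simp add: prod.distrib Q_def flip: power_mult mult.assoc)
  have t_eq: "t k = (- 1) ^ k * fps_X ^ (M * (k choose 2) + n * k + M * L * (2 * L - k)) * g k (2 * L - k)" for k
    unfolding t_def v_pow Q_def u_def power_mult[symmetric] by (simp add: power_add mult_ac)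
  have low_term: "t (L - p) = C * ((- 1) ^ p * fps_X ^ (n * p\<^sup>2 + (Suc p choose 2)) * g (L - p) (L + p))"
    if "p \<le> L" for p
  proof -
    obtain r where r: "L = p + r" using le_Suc_ex[OF \<open>p \<le> L\<close>] by blast
    have 1: "p * p = 2 * (p choose 2) + p" by (rule square_eq_choose_2)
    have 2: "p * (p * x) = (2 * (p choose 2) + p) * x" for x by (simp only: 1 mult.assoc[symmetric])
    have "M * (r choose 2) + n * r + M * L * (L + p)
        = M * (L choose 2) + n * L + M * (L * L) + (n * p\<^sup>2 + ((p choose 2) + p))"
      unfolding r choose_2_add M_def power2_eq_square by (simp add: algebra_simps 1 2)
    also have "(p choose 2) + p = Suc p choose 2" by (simp add: numeral_2_eq_2)
    finally have e: "M * (r choose 2) + n * r + M * L * (L + p)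
        = M * (L choose 2) + n * L + M * (L * L) + (n * p\<^sup>2 + (Suc p choose 2))" .
    have sgn: "(- 1 :: int fps) ^ r = (- 1) ^ L * (- 1) ^ p"
      by (simp add: r minus_one_power_iff)
    have "L - p = r" "2 * L - r = L + p" using r by auto
    then have "t (L - p) = (- 1) ^ r * fps_X ^ (M * (r choose 2) + n * r + M * L * (L + p)) * g (L - p) (L + p)"
      by (simp only: t_eq)
    also have "\<dots> = C * ((- 1) ^ p * fps_X ^ (n * p\<^sup>2 + (Suc p choose 2)) * g (L - p) (L + p))"
      unfolding e sgn C_def power_add by (simp only: mult_ac)
    finally show ?thesis .
  qed
  have high_term: "t (L + Suc p) = - (C * ((- 1) ^ p * fps_X ^ (n * p\<^sup>2 + (Suc p choose 2) + (2 * p + 1) * n) * g (L + p + 1) (L - p - 1)))"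
    if "p < L" for p
  proof -
    obtain r where r: "L = Suc p + r" using le_Suc_ex[of "Suc p" L] \<open>p < L\<close> by auto
    have 1: "p * p + p = 2 * (Suc p choose 2)" using square_eq_choose_2[of "Suc p"] by simp
    have 2: "n * (p * p + p) = n * (2 * (Suc p choose 2))" by (simp only: 1)
    have e: "M * ((L + Suc p) choose 2) + n * (L + Suc p) + M * L * r
        = M * (L choose 2) + n * L + M * (L * L) + (n * p\<^sup>2 + (Suc p choose 2) + (2 * p + 1) * n)"
      unfolding choose_2_add[of L "Suc p"] M_def power2_eq_square using 2 by (simp add: r algebra_simps)
    have "L - p - 1 = r" "2 * L - (L + Suc p) = r" "L + p + 1 = L + Suc p" using r by auto
    then have "t (L + Suc p) = (- 1) ^ (L + Suc p) * fps_X ^ (M * ((L + Suc p) choose 2) + n * (L + Suc p) + M * L * r) * g (L + p + 1) (L - p - 1)"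
      by (simp only: t_eq)
    also have "\<dots> = - (C * ((- 1) ^ p * fps_X ^ (n * p\<^sup>2 + (Suc p choose 2) + (2 * p + 1) * n) * g (L + p + 1) (L - p - 1)))"
      unfolding e C_def power_add by (simp add: mult_ac)
    finally show ?thesis .
  qed
  have "C * (\<Prod>j<L. (1 - fps_X ^ (M * j + n)) * (1 - fps_X ^ (M * j + n + 1))) = (\<Prod>j<L + L. u + v * Q ^ j)"
    unfolding prod_lessThan_add low high prod.distrib C_def by (simp add: power_add mult_ac)
  also have "\<dots> = (\<Sum>k<Suc L + L. t k)"
    using gauss_binomial_theorem[of u v Q "2 * L"] by (simp add: t_def g_def Q_def lessThan_Suc_atMost mult_2)
  also have "\<dots> = (\<Sum>p\<le>L. t (L - p)) + (\<Sum>p<L. t (L + Suc p))"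
    using sum.nat_diff_reindex[of t "Suc L"]
    by (simp only: sum_lessThan_add) (simp add: lessThan_Suc_atMost)
  also have "\<dots> = C * ((\<Sum>p\<le>L. (- 1) ^ p * fps_X ^ (n * p\<^sup>2 + (Suc p choose 2)) * g (L - p) (L + p)) -
    (\<Sum>p<L. (- 1) ^ p * fps_X ^ (n * p\<^sup>2 + (Suc p choose 2) + (2 * p + 1) * n) * g (L + p + 1) (L - p - 1)))"
  proof -
    have "(\<Sum>p\<le>L. t (L - p)) = (\<Sum>p\<le>L. C * ((- 1) ^ p * fps_X ^ (n * p\<^sup>2 + (Suc p choose 2)) * g (L - p) (L + p)))"
      by (intro sum.cong refl low_term) simp
    moreover have "(\<Sum>p<L. t (L + Suc p)) = (\<Sum>p<L. - (C * ((- 1) ^ p * fps_X ^ (n * p\<^sup>2 + (Suc p choose 2) + (2 * p + 1) * n) * g (L + p + 1) (L - p - 1))))"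
      by (intro sum.cong refl high_term) simp
    ultimately show ?thesis
      by (simp only: right_diff_distrib sum_distrib_left sum_negf add_uminus_conv_diff)
  qed
  finally show ?thesis
    by (simp add: C_def)
qed


text \<open>Each block of M consecutive indices contributes one index for each of the residues n, n
  + 1 and 0, the last one being the end M * Suc L of the block.\<close>

lemma prod_mod_period:
  fixes f :: "nat \<Rightarrow> 'a::comm_monoid_mult"
  assumes "n \<ge> 1" "M = 2 * n + 1"
  shows "(\<Prod>i\<le>M * L. if i \<ge> 1 \<and> i mod M \<in> {0, n, n + 1} then f i else 1)
    = (\<Prod>j<L. f (M * j + n) * f (M * j + n + 1) * f (M * Suc j))"
proof (induction L)
  case (Suc L)
  let ?f = "\<lambda>i. if i \<ge> 1 \<and> i mod M \<in> {0, n, n + 1} then f i else 1"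
  let ?B = "{M * L + n, M * L + n + 1, M * L + M}"
  have zero: "?f i = 1" if "i \<in> {M * L <.. M * L + M} - ?B" for i
  proof -
    define r where "r = i - M * L"
    have r: "i = M * L + r" "0 < r" "r \<le> M" "r \<noteq> n" "r \<noteq> n + 1" "r \<noteq> M"
      using that by (auto simp: r_def)
    then have "i mod M = r" by simp
    then show ?thesis using r by auto
  qed
  have "(\<Prod>i\<le>M * Suc L. ?f i) = prod ?f ({..M * L} \<union> {M * L <.. M * L + M})"
    by (intro prod.cong) auto
  also have "\<dots> = (\<Prod>i\<le>M * L. ?f i) * prod ?f {M * L <.. M * L + M}"
    by (intro prod.union_disjoint) auto
  also have "prod ?f {M * L <.. M * L + M} = prod ?f ?B"
    using assms zero by (intro prod.mono_neutral_right) auto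
  also have "prod ?f ?B = f (M * L + n) * f (M * L + n + 1) * f (M * Suc L)"
  proof -
    have "n < M" "n + 1 < M" using assms by auto
    then have "(M * L + n) mod M = n" "(M * L + n + 1) mod M = n + 1" "(M * L + M) mod M = 0"
      unfolding add.assoc by simp_all
    then have "?f (M * L + n) = f (M * L + n)" "?f (M * L + n + 1) = f (M * L + n + 1)"
        "?f (M * L + M) = f (M * Suc L)"
      using assms by (simp_all add: add.commute)
    moreover have "prod ?f ?B = ?f (M * L + n) * (?f (M * L + n + 1) * ?f (M * L + M))"
      using assms by (subst prod.insert; simp)+
    ultimately show ?thesis by (simp only: mult.assoc)
  qed
  finally show ?case by (simp only: Suc.IH prod.lessThan_Suc)
qed simp

text \<open>The factors in the class of 0 make up \<open>E L\<close>, and multiplying by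
  \<open>E L\<close> turns the Gaussian binomials of the finite identity into 1 modulo t^W. Terms
  with p at least W vanish because their exponents are at least p.\<close>

lemma jacobi_triple_product_cong:
  fixes n :: nat
  assumes "n \<ge> 1"
  shows "fps_cong W (prodinf (\<lambda>i. if i \<ge> 1 \<and> i mod (2 * n + 1) \<in> {0, n, n + 1} then 1 - fps_X ^ i else 1))
    (\<Sum>p<W. (- 1) ^ p * fps_X ^ (n * p\<^sup>2 + (Suc p choose 2)) * (1 - fps_X ^ ((2 * p + 1) * n)))"
proof -
  define M where "M = 2 * n + 1"
  \<comment> \<open>With L = 2 W both arguments of every Gaussian binomial are at least W as long as
    p < W.\<close>
  define L where "L = 2 * W"
  define g :: "nat \<Rightarrow> nat \<Rightarrow> int fps" where "g = gauss_binom (fps_X ^ M)"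
  define E where "E l = (\<Prod>r=1..l. 1 - ((fps_X :: int fps) ^ M) ^ r)" for l
  define e where "e p = n * p\<^sup>2 + (Suc p choose 2)" for p
  let ?f = "\<lambda>i. if i \<ge> 1 \<and> i mod M \<in> {0, n, n + 1} then 1 - fps_X ^ i else (1 :: int fps)"
  have M: "M \<ge> 1" by (simp add: M_def)
  have E: "fps_cong W (E l) (E W)" if "l \<ge> W" for l
    unfolding E_def power_mult[symmetric]
  proof (rule fps_cong_prod_mono)
    show "fps_cong W (1 - fps_X ^ (M * i)) 1" if "i \<in> {1..l} - {1..W}" for i
    proof -
      have "1 * W \<le> M * i" using that M by (intro mult_le_mono) auto
      then show ?thesis by (intro fps_cong_one_minus_X_power) simp
    qed
  qed (use that in auto)
  have E0: "E l $ 0 = 1" for l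
    using M unfolding E_def power_mult[symmetric] by (induction l) (simp_all add: fps_mult_nth_0 fps_X_power_nth)
  \<comment> \<open>The Gaussian binomial is E (a + b) / (E a * E b), and all these products agree
    with \<open>E W\<close> modulo t^W.\<close>
  have gE: "fps_cong W (g a b * E L) 1" if "a \<ge> W" "b \<ge> W" for a b
  proof (rule fps_cong_cancel[OF E0[of W]])
    have "fps_cong W (E W * (g a b * E L)) (E a * (g a b * E b))"
      using that E[of L] E[of a] E[of b]
      by (intro fps_cong_mult fps_cong_refl) (auto simp: L_def fps_cong_iff)
    also have "E a * (g a b * E b) = E (a + b)"
      using gauss_binom_fact[of "fps_X ^ M" a b] by (simp add: E_def g_def mult_ac)
    also have "fps_cong W (E (a + b)) (E W * 1)"
      using that E by simp
    finally show "fps_cong W (E W * (g a b * E L)) (E W * 1)" .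
  qed
  have e_ge: "p \<le> e p" for p
    by (induction p) (simp_all add: e_def numeral_2_eq_2)
  have monom: "fps_cong W ((- 1) ^ p * fps_X ^ d * g a b * E L) ((- 1) ^ p * fps_X ^ d)"
    if "(a \<ge> W \<and> b \<ge> W) \<or> d \<ge> W" for p d a b
    using that
  proof
    assume "a \<ge> W \<and> b \<ge> W"
    then show ?thesis
      using fps_cong_mult[OF fps_cong_refl[of W "(- 1) ^ p * fps_X ^ d"] gE[of a b]] by (simp add: mult.assoc)
  next
    assume "d \<ge> W"
    then have "fps_cong W (fps_X ^ d * ((- 1) ^ p * g a b * E L)) 0" "fps_cong W (fps_X ^ d * (- 1) ^ p) 0"
      by (rule fps_cong_monom_0)+
    then show ?thesis by (simp add: fps_cong_iff mult_ac)
  qed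
  have eq: "(\<Prod>j<L. (1 - fps_X ^ (M * j + n)) * (1 - fps_X ^ (M * j + n + 1))) =
    (\<Sum>p\<le>L. (- 1) ^ p * fps_X ^ e p * g (L - p) (L + p)) -
    (\<Sum>p<L. (- 1) ^ p * fps_X ^ (e p + (2 * p + 1) * n) * g (L + p + 1) (L - p - 1))"
    unfolding M_def g_def e_def by (rule finite_jacobi_triple_product)
  have "fps_cong W (prodinf ?f) (\<Prod>i\<le>M * L. ?f i)"
  proof (intro prodinf_fps_cong)
    have "1 * W \<le> M * L" using M by (intro mult_le_mono) (auto simp: L_def)
    then show "{..<W} \<subseteq> {..M * L}" by auto
  qed (auto simp: fps_cong_one_minus_X_power)
  also have "(\<Prod>i\<le>M * L. ?f i) =
      (\<Prod>j<L. (1 - fps_X ^ (M * j + n)) * (1 - fps_X ^ (M * j + n + 1))) * (\<Prod>j<L. 1 - fps_X ^ (M * Suc j))"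
    by (simp only: prod_mod_period[OF assms M_def] prod.distrib)
  also have "(\<Prod>j<L. 1 - fps_X ^ (M * Suc j)) = E L"
    unfolding E_def power_mult[symmetric] by (simp add: prod.atLeast1_atMost_eq)
  also have "(\<Prod>j<L. (1 - fps_X ^ (M * j + n)) * (1 - fps_X ^ (M * j + n + 1))) * E L =
    (\<Sum>p\<le>L. (- 1) ^ p * fps_X ^ e p * g (L - p) (L + p) * E L) +
    (\<Sum>p<L. - 1 * ((- 1) ^ p * fps_X ^ (e p + (2 * p + 1) * n) * g (L + p + 1) (L - p - 1) * E L))"
    unfolding eq by (simp add: left_diff_distrib sum_distrib_right sum_negf)
  also have "fps_cong W \<dots> ((\<Sum>p\<le>L. (- 1) ^ p * fps_X ^ e p) + (\<Sum>p<L. - 1 * ((- 1) ^ p * fps_X ^ (e p + (2 * p + 1) * n))))"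
  proof (intro fps_cong_add fps_cong_sum monom fps_cong_mult[OF fps_cong_refl monom])
    fix p
    show "W \<le> L - p \<and> W \<le> L + p \<or> W \<le> e p"
      using e_ge[of p] by (auto simp: L_def)
    show "W \<le> L + p + 1 \<and> W \<le> L - p - 1 \<or> W \<le> e p + (2 * p + 1) * n"
      using e_ge[of p] by (auto simp: L_def)
  qed
  also have "fps_cong W \<dots> ((\<Sum>p<W. (- 1) ^ p * fps_X ^ e p) + (\<Sum>p<W. - 1 * ((- 1) ^ p * fps_X ^ (e p + (2 * p + 1) * n))))"
  proof -
    have cut: "fps_cong W (sum h A) (sum h {..<W})"
      if "finite A" "{..<W} \<subseteq> A" "\<And>p. p \<ge> W \<Longrightarrow> fps_cong W (h p) 0" for h :: "nat \<Rightarrow> int fps" and A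
    proof -
      have "fps_cong W (sum h (A - {..<W}) + sum h {..<W}) ((\<Sum>p\<in>A - {..<W}. 0) + sum h {..<W})"
        by (intro fps_cong_add fps_cong_sum fps_cong_refl that) auto
      then show ?thesis using sum.subset_diff[OF that(2,1), of h] by simp
    qed
    have zero: "fps_cong W (h * fps_X ^ d) 0" if "W \<le> d" for d h
      using fps_cong_monom_0[OF that, of h] by (simp only: mult.commute)
    have "fps_cong W ((- 1) ^ p * fps_X ^ e p) 0" if "p \<ge> W" for p
      using that e_ge[of p] by (intro zero) linarith
    moreover have "fps_cong W (- 1 * ((- 1) ^ p * fps_X ^ (e p + (2 * p + 1) * n))) 0" if "p \<ge> W" for p
      using that e_ge[of p] unfolding mult.assoc[symmetric] by (intro zero) linarith
    ultimately show ?thesis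
      by (intro fps_cong_add cut) (auto simp: L_def)
  qed
  also have "\<dots> = (\<Sum>p<W. (- 1) ^ p * fps_X ^ e p * (1 - fps_X ^ ((2 * p + 1) * n)))"
    unfolding sum.distrib[symmetric] by (simp add: right_diff_distrib power_add mult.assoc)
  finally show ?thesis
    by (simp add: M_def e_def)
qed

section \<open>Gordon's identity\<close>

text \<open>Andrews's series solving Gordon's recursion at \<open>x = q\<^sup>N\<close>, multiplied by
  \<open>\<Prod>\<^sub>r (1 - q\<^sup>r)\<close> and truncated to the terms \<open>m < W\<close>, which determine it modulo \<open>q\<^sup>W\<close>.\<close>

definition gordon_sum :: "nat \<Rightarrow> nat \<Rightarrow> nat \<Rightarrow> nat \<Rightarrow> int fps"
  where "gordon_sum k W i N = (\<Sum>m<W. (- 1) ^ m *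
    fps_X ^ (N * k * m + k * m\<^sup>2 + (Suc m choose 2) + (k - i) * m) *
    (1 - fps_X ^ ((N + 2 * m + 1) * i)) * (\<Prod>r=1..N. 1 - fps_X ^ (m + r)))"

lemma gordon_sum_0 [simp]: "gordon_sum k W 0 N = 0"
  by (simp add: gordon_sum_def)

lemma le_Suc_choose_2: "m \<le> Suc m choose 2"
  by (induction m) (simp_all add: numeral_2_eq_2)

text \<open>Termwise the two sides differ by the telescoping F m - F (Suc m). \<open>F 0\<close>
  vanishes through its factor 1 - t^0, and \<open>F W\<close> is divisible by t^W, so only the
  truncation makes this a congruence.\<close>

lemma gordon_sum_rec:
  assumes "i < k"
  shows "fps_cong W (gordon_sum k W (Suc i) N)
    (gordon_sum k W i N + fps_X ^ ((N + 1) * i) * gordon_sum k W (k - i) (Suc N))"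
proof -
  obtain d where k: "k = Suc d + i"
    using assms less_imp_Suc_add[of i k] by (auto simp: add.commute)
  define P where "P m = (\<Prod>r=1..N. 1 - (fps_X :: int fps) ^ (m + r))" for m
  define t where "t i N m = (- 1) ^ m * fps_X ^ (N * k * m + k * m\<^sup>2 + (Suc m choose 2) + (k - i) * m) *
    (1 - fps_X ^ ((N + 2 * m + 1) * i)) * (\<Prod>r=1..N. 1 - (fps_X :: int fps) ^ (m + r))" for i N m
  define F where "F m = (- 1) ^ m * fps_X ^ (N * k * m + k * m\<^sup>2 + (Suc m choose 2) + d * m) *
    ((1 - (fps_X :: int fps) ^ m) * P m)" for m
  have step: "t (Suc i) N m = t i N m + fps_X ^ ((N + 1) * i) * t (k - i) (Suc N) m + (F m - F (Suc m))" for m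
  proof -
    define s u a Y R w :: "int fps" where defs: "s = (- 1) ^ m"
      "u = fps_X ^ (N * k * m + k * m\<^sup>2 + (Suc m choose 2) + d * m)"
      "a = fps_X ^ m" "Y = fps_X ^ ((N + 2 * m + 1) * i)"
      "R = fps_X ^ ((N + 2 * m + 2) * Suc d)" "w = fps_X ^ (N + m + 1)"
    have P_Suc: "(\<Prod>r=1..Suc N. 1 - fps_X ^ (m + r)) = P m * (1 - w)"
      by (simp add: P_def defs add.commute)
    have "(\<Prod>r=1..Suc N. 1 - (fps_X :: int fps) ^ (m + r)) = (\<Prod>r\<le>N. 1 - fps_X ^ (m + Suc r))"
      by (simp only: One_nat_def prod.atLeast1_atMost_eq lessThan_Suc_atMost)
    also have "\<dots> = (1 - fps_X ^ Suc m) * (\<Prod>r=1..N. 1 - fps_X ^ (m + Suc r))"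
      by (simp only: prod.atMost_shift) (simp add: prod.atLeast1_atMost_eq)
    also have "\<dots> = (1 - fps_X ^ Suc m) * P (Suc m)"
      by (simp add: P_def)
    \<comment> \<open>Both sides are the product of 1 - t^(m+r) for r from 1 to N + 1, with the
      first or the last factor split off; this relates \<open>F (Suc m)\<close> to the term
      m.\<close>
    finally have shift: "(1 - fps_X ^ Suc m) * P (Suc m) = P m * (1 - w)"
      by (simp only: P_Suc)
    have t1: "t (Suc i) N m = s * u * (1 - Y * a * w) * P m"
    proof -
      have "k - Suc i = d" by (simp add: k)
      moreover have "fps_X ^ ((N + 2 * m + 1) * Suc i) = Y * a * w"
        unfolding defs power_add[symmetric] by (simp add: algebra_simps)
      ultimately show ?thesis by (simp only: t_def P_def defs(1,2))
    qed
    have t2: "t i N m = s * (u * a) * (1 - Y) * P m"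
    proof -
      have "N * k * m + k * m\<^sup>2 + (Suc m choose 2) + (k - i) * m
          = N * k * m + k * m\<^sup>2 + (Suc m choose 2) + d * m + m"
        by (simp add: k)
      then have "fps_X ^ (N * k * m + k * m\<^sup>2 + (Suc m choose 2) + (k - i) * m) = u * a"
        by (simp only: defs power_add)
      then show ?thesis by (simp only: t_def P_def defs(1,4))
    qed
    have t3: "fps_X ^ ((N + 1) * i) * t (k - i) (Suc N) m = s * (u * a * Y) * (1 - R) * (P m * (1 - w))"
    proof -
      have "(N + 1) * i + (Suc N * k * m + k * m\<^sup>2 + (Suc m choose 2) + (k - (k - i)) * m)
        = N * k * m + k * m\<^sup>2 + (Suc m choose 2) + d * m + m + (N + 2 * m + 1) * i"
        by (simp add: k algebra_simps)
      then have *: "fps_X ^ ((N + 1) * i) * fps_X ^ (Suc N * k * m + k * m\<^sup>2 + (Suc m choose 2) + (k - (k - i)) * m)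
          = u * a * Y"
        by (simp only: defs power_add[symmetric])
      have "fps_X ^ ((Suc N + 2 * m + 1) * (k - i)) = R"
        by (simp add: defs k)
      then show ?thesis
        unfolding t_def P_Suc *[symmetric] defs(1) by (simp only: mult_ac)
    qed
    have F2: "F (Suc m) = - (s * (u * a * Y * R) * (P m * (1 - w)))"
    proof -
      have "N * k * Suc m + k * (Suc m)\<^sup>2 + (Suc (Suc m) choose 2) + d * Suc m
        = N * k * m + k * m\<^sup>2 + (Suc m choose 2) + d * m + m + (N + 2 * m + 1) * i + (N + 2 * m + 2) * Suc d"
        by (simp add: k algebra_simps power2_eq_square numeral_2_eq_2)
      then have "fps_X ^ (N * k * Suc m + k * (Suc m)\<^sup>2 + (Suc (Suc m) choose 2) + d * Suc m) = u * a * Y * R"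
        by (simp only: defs power_add[symmetric])
      then show ?thesis
        unfolding F_def shift by (simp add: defs(1))
    qed
    have F1: "F m = s * u * ((1 - a) * P m)"
      by (simp only: F_def defs)
    show ?thesis
      unfolding t1 t2 t3 F1 F2 by (simp add: algebra_simps)
  qed
  have "gordon_sum k W (Suc i) N = (\<Sum>m<W. t (Suc i) N m)"
    by (simp only: gordon_sum_def t_def)
  also have "\<dots> = (\<Sum>m<W. t i N m) + fps_X ^ ((N + 1) * i) * (\<Sum>m<W. t (k - i) (Suc N) m) + (F 0 - F W)"
    by (simp only: step sum.distrib sum_distrib_left[symmetric] sum_lessThan_telescope')
  also have "F 0 - F W = - F W"
    by (simp add: F_def)
  finally have eq: "gordon_sum k W (Suc i) N = gordon_sum k W i N +
      fps_X ^ ((N + 1) * i) * gordon_sum k W (k - i) (Suc N) + - F W"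
    by (simp only: gordon_sum_def t_def)
  have "fps_cong W (- F W) 0"
  proof -
    have "W \<le> N * k * W + k * W\<^sup>2 + (Suc W choose 2) + d * W"
      using le_Suc_choose_2[of W] by linarith
    from fps_cong_monom_0[OF this, of "- ((- 1) ^ W * ((1 - fps_X ^ W) * P W))"] show ?thesis
      by (simp add: F_def mult_ac)
  qed
  from fps_cong_add[OF fps_cong_refl this] show ?thesis
    unfolding eq by simp
qed

text \<open>At N = W the exponent of every term m > 0 contains W k m, which is at least W, so only
  the term m = 0 survives.\<close>

lemma gordon_sum_limit:
  assumes "1 \<le> i" "i \<le> k"
  shows "fps_cong W (gordon_sum k W i W) euler_fps"
proof (cases W)
  case (Suc V)
  define t where "t m = (- 1) ^ m * fps_X ^ (W * k * m + k * m\<^sup>2 + (Suc m choose 2) + (k - i) * m) *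
    (1 - fps_X ^ ((W + 2 * m + 1) * i)) * (\<Prod>r=1..W. 1 - (fps_X :: int fps) ^ (m + r))" for m
  have t0: "fps_cong W (t m) 0" if "m \<noteq> 0" for m
  proof -
    have "W * 1 * 1 \<le> W * k * m" using that assms by (intro mult_le_mono) auto
    then have "W \<le> W * k * m + k * m\<^sup>2 + (Suc m choose 2) + (k - i) * m" by linarith
    from fps_cong_monom_0[OF this] show ?thesis
      unfolding t_def by (simp only: mult.assoc mult.left_commute[of "(- 1) ^ m"])
  qed
  have "gordon_sum k W i W = (\<Sum>m<W. t m)"
    by (simp only: gordon_sum_def t_def)
  also have "\<dots> = t 0 + (\<Sum>m<V. t (Suc m))"
    unfolding Suc by (rule sum.lessThan_Suc_shift)
  also have "fps_cong W \<dots> ((\<Prod>r=1..W. 1 - fps_X ^ r) + (\<Sum>m<V. 0))"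
  proof (intro fps_cong_add fps_cong_sum)
    have "t 0 = (1 - fps_X ^ ((W + 1) * i)) * (\<Prod>r=1..W. 1 - fps_X ^ r)"
      by (simp add: t_def binomial_eq_0)
    moreover have "W * 1 \<le> (W + 1) * i" using assms by (intro mult_le_mono) auto
    then have "fps_cong W (1 - fps_X ^ ((W + 1) * i)) 1"
      by (intro fps_cong_one_minus_X_power) simp
    ultimately show "fps_cong W (t 0) (\<Prod>r=1..W. 1 - fps_X ^ r)"
      using fps_cong_mult[OF _ fps_cong_refl] by fastforce
  qed (simp add: t0)
  also have "fps_cong W ((\<Prod>r=1..W. 1 - fps_X ^ r) + (\<Sum>m<V. 0)) euler_fps"
    using fps_cong_sym[OF euler_fps_cong[of W W]] by simp
  finally show ?thesis .
qed (simp add: fps_cong_iff)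


section \<open>Standard monomials and their generating functions\<close>

definition mon_sum :: "(nat \<Rightarrow> nat) \<Rightarrow> (nat \<Rightarrow>\<^sub>0 nat) \<Rightarrow> nat"
  where "mon_sum f \<nu> = (\<Sum>i\<in>Poly_Mapping.keys \<nu>. f i * Poly_Mapping.lookup \<nu> i)"

text \<open>Two other choices of \<open>f\<close> are used: the constant 1 gives the degree, and the
  square gives the quantity Q that orders the monomials.\<close>

lemma arc_weight_eq_mon_sum: "arc_weight = mon_sum Suc"
  by (simp add: fun_eq_iff arc_weight_def mon_sum_def)

lemma mon_sum_superset:
  assumes "finite A" "Poly_Mapping.keys \<nu> \<subseteq> A"
  shows "mon_sum f \<nu> = (\<Sum>i\<in>A. f i * Poly_Mapping.lookup \<nu> i)"
  unfolding mon_sum_def using assms by (intro sum.mono_neutral_left) (auto simp: in_keys_iff)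

lemma mon_sum_zero [simp]: "mon_sum f 0 = 0"
  by (simp add: mon_sum_def)

lemma mon_sum_add [simp]: "mon_sum f (\<mu> + \<nu>) = mon_sum f \<mu> + mon_sum f \<nu>"
  unfolding mon_sum_def by (rule setsum_keys_plus_distrib) (simp_all add: distrib_left)

lemma mon_sum_single [simp]: "mon_sum f (Poly_Mapping.single i a) = f i * a"
  by (simp add: mon_sum_def)

lemma mon_sum_sum: "mon_sum f (\<Sum>j\<in>J. g j) = (\<Sum>j\<in>J. mon_sum f (g j))"
  by (induction J rule: infinite_finite_induct) simp_all

lemma le_mon_sum: "f i * Poly_Mapping.lookup \<nu> i \<le> mon_sum f \<nu>"
proof (cases "i \<in> Poly_Mapping.keys \<nu>")
  case True
  then show ?thesis
    unfolding mon_sum_def using member_le_sum[of i "Poly_Mapping.keys \<nu>" "\<lambda>i. f i * Poly_Mapping.lookup \<nu> i"] by simp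
qed (simp add: in_keys_iff)

text \<open>Exponents are indexed from \<open>0\<close>: the index \<open>N\<close> belongs to the part \<open>N + 1\<close>. For \<open>N = 0\<close> and \<open>i = n\<close>
  these are the standard monomials.\<close>

definition gordon_mons :: "nat \<Rightarrow> nat \<Rightarrow> nat \<Rightarrow> (nat \<Rightarrow>\<^sub>0 nat) set"
  where "gordon_mons n i N = {\<nu>. (\<forall>x<N. Poly_Mapping.lookup \<nu> x = 0) \<and> Poly_Mapping.lookup \<nu> N < i \<and>
    (\<forall>x. Poly_Mapping.lookup \<nu> x + Poly_Mapping.lookup \<nu> (Suc x) < n)}"

definition gordon_fps :: "nat \<Rightarrow> nat \<Rightarrow> nat \<Rightarrow> int fps"
  where "gordon_fps n i N = Abs_fps (\<lambda>w. int (card {\<nu> \<in> gordon_mons n i N. arc_weight \<nu> = w}))"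

lemma gordon_fps_0 [simp]: "gordon_fps n 0 N = 0"
  by (simp add: gordon_fps_def gordon_mons_def fps_eq_iff)

text \<open>The new monomials have exponent exactly i at N. Once this power is removed, the
  condition on the exponents at N and N + 1 becomes the bound n - i on the exponent at N +
  1.\<close>

lemma gordon_mons_Suc:
  assumes "i < n"
  shows "gordon_mons n (Suc i) N = gordon_mons n i N \<union>
    (\<lambda>\<nu>. \<nu> + Poly_Mapping.single N i) ` gordon_mons n (n - i) (Suc N)" (is "_ = _ \<union> ?S")
proof (intro subset_antisym subsetI)
  fix \<nu> assume \<nu>: "\<nu> \<in> gordon_mons n (Suc i) N"
  show "\<nu> \<in> gordon_mons n i N \<union> ?S"
  proof (cases "Poly_Mapping.lookup \<nu> N = i")
    case True
    define \<mu> where "\<mu> = \<nu> - Poly_Mapping.single N i"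
    have lookup: "Poly_Mapping.lookup \<mu> x = (if x = N then 0 else Poly_Mapping.lookup \<nu> x)" for x
      using True by (simp add: \<mu>_def lookup_minus lookup_single when_def)
    have "\<nu> = \<mu> + Poly_Mapping.single N i"
      using True by (intro poly_mapping_eqI) (auto simp: lookup lookup_add lookup_single when_def)
    moreover have "\<mu> \<in> gordon_mons n (n - i) (Suc N)"
    proof -
      have "Poly_Mapping.lookup \<nu> x + Poly_Mapping.lookup \<nu> (Suc x) < n" for x
        using \<nu> by (simp add: gordon_mons_def)
      from this[of N] this show ?thesis
        using \<nu> True
        by (auto simp: gordon_mons_def lookup less_Suc_eq intro: le_less_trans[rotated])
    qed
    ultimately show ?thesis by blast
  qed (use \<nu> in \<open>auto simp: gordon_mons_def\<close>)
next
  fix \<nu> assume "\<nu> \<in> gordon_mons n i N \<union> ?S"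
  then show "\<nu> \<in> gordon_mons n (Suc i) N"
  proof
    assume "\<nu> \<in> ?S"
    then obtain \<mu> where \<mu>: "\<mu> \<in> gordon_mons n (n - i) (Suc N)" "\<nu> = \<mu> + Poly_Mapping.single N i" by blast
    have lookup: "Poly_Mapping.lookup \<nu> x = (if x = N then i else Poly_Mapping.lookup \<mu> x)" for x
      using \<mu> by (simp add: gordon_mons_def lookup_add lookup_single when_def)
    have "Poly_Mapping.lookup \<nu> x + Poly_Mapping.lookup \<nu> (Suc x) < n" for x
    proof -
      have "Poly_Mapping.lookup \<mu> x + Poly_Mapping.lookup \<mu> (Suc x) < n" "Poly_Mapping.lookup \<mu> (Suc N) < n - i"
        "x < Suc N \<Longrightarrow> Poly_Mapping.lookup \<mu> x = 0"
        using \<mu> by (auto simp: gordon_mons_def)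
      then show ?thesis using assms by (auto simp: lookup)
    qed
    then show ?thesis
      using \<mu>(1) by (simp add: gordon_mons_def lookup)
  qed (auto simp: gordon_mons_def)
qed

lemma gordon_fps_Suc:
  assumes "i < n"
  shows "gordon_fps n (Suc i) N = gordon_fps n i N + fps_X ^ ((N + 1) * i) * gordon_fps n (n - i) (Suc N)"
proof (rule fps_ext)
  fix w
  let ?A = "{\<nu> \<in> gordon_mons n i N. arc_weight \<nu> = w}"
  let ?S = "(\<lambda>\<nu>. \<nu> + Poly_Mapping.single N i) ` gordon_mons n (n - i) (Suc N)"
  let ?B = "{\<nu> \<in> ?S. arc_weight \<nu> = w}"
  have fin: "finite {\<nu> \<in> T. arc_weight \<nu> = w}" for T w
    by (rule finite_subset[OF _ finite_arc_weight[of w]]) auto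
  have "{\<nu> \<in> gordon_mons n (Suc i) N. arc_weight \<nu> = w} = ?A \<union> ?B"
    by (auto simp: gordon_mons_Suc[OF assms])
  \<comment> \<open>The exponent at N is below i in \<open>?A\<close> and at least i in
    \<open>?B\<close>.\<close>
  moreover have "?A \<inter> ?B = {}"
    by (auto simp: gordon_mons_def lookup_add)
  ultimately have "card {\<nu> \<in> gordon_mons n (Suc i) N. arc_weight \<nu> = w} = card ?A + card ?B"
    using fin by (simp add: card_Un_disjoint)
  moreover have "card ?B = (if w < (N + 1) * i then 0
      else card {\<nu> \<in> gordon_mons n (n - i) (Suc N). arc_weight \<nu> = w - (N + 1) * i})"
  proof -
    have "?B = (\<lambda>\<nu>. \<nu> + Poly_Mapping.single N i) `
        {\<nu> \<in> gordon_mons n (n - i) (Suc N). arc_weight \<nu> + (N + 1) * i = w}"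
      by (auto simp: arc_weight_eq_mon_sum)
    then have "card ?B = card {\<nu> \<in> gordon_mons n (n - i) (Suc N). arc_weight \<nu> + (N + 1) * i = w}"
      by (simp add: card_image inj_on_def)
    moreover have "w < (N + 1) * i \<Longrightarrow> {\<nu> \<in> gordon_mons n (n - i) (Suc N). arc_weight \<nu> + (N + 1) * i = w} = {}"
      by auto
    moreover have "\<not> w < (N + 1) * i \<Longrightarrow> arc_weight \<nu> + (N + 1) * i = w \<longleftrightarrow> arc_weight \<nu> = w - (N + 1) * i" for \<nu>
      by auto
    ultimately show ?thesis by simp
  qed
  ultimately show "gordon_fps n (Suc i) N $ w =
      (gordon_fps n i N + fps_X ^ ((N + 1) * i) * gordon_fps n (n - i) (Suc N)) $ w"
    by (simp add: gordon_fps_def fps_X_power_mult_nth)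
qed

text \<open>All variables still allowed have weight above N, so 1 is the only monomial of weight
  below N.\<close>

lemma gordon_fps_limit:
  assumes "1 \<le> i" "1 \<le> n"
  shows "fps_cong N (gordon_fps n i N) 1"
  unfolding fps_cong_iff
proof safe
  fix w assume w: "w < N"
  have zero: "\<nu> = 0" if "\<nu> \<in> gordon_mons n i N" "arc_weight \<nu> = w" for \<nu>
  proof (rule poly_mapping_eqI)
    fix x
    show "Poly_Mapping.lookup \<nu> x = Poly_Mapping.lookup 0 x"
    proof (cases "x < N")
      case False
      have "Suc x * Poly_Mapping.lookup \<nu> x \<le> w"
        using le_mon_sum[of Suc x \<nu>] that by (simp only: arc_weight_eq_mon_sum)
      then have "Suc x * Poly_Mapping.lookup \<nu> x < Suc x * 1" using w False by simp
      then show ?thesis by (simp only: mult_less_cancel1) simp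
    qed (use that in \<open>simp add: gordon_mons_def\<close>)
  qed
  have "0 \<in> gordon_mons n i N" "arc_weight 0 = 0"
    using assms by (auto simp: gordon_mons_def arc_weight_def)
  then have "\<nu> \<in> gordon_mons n i N \<and> arc_weight \<nu> = w \<longleftrightarrow> \<nu> = 0 \<and> w = 0" for \<nu>
    using zero[of \<nu>] by metis
  then have "{\<nu> \<in> gordon_mons n i N. arc_weight \<nu> = w} = (if w = 0 then {0} else {})"
    by simp
  then show "gordon_fps n i N $ w = 1 $ w"
    by (simp add: gordon_fps_def)
qed

text \<open>Both sides satisfy the same recursion modulo t^W. The outer induction descends from N =
  W, where both are the Euler product unless i = 0; the inner one ascends from i = 0, where both are
  0.\<close>

lemma euler_gordon_fps_cong:
  assumes "N \<le> W" "i \<le> n" "1 \<le> n"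
  shows "fps_cong W (euler_fps * gordon_fps n i N) (gordon_sum n W i N)"
  using assms(1,2)
proof (induction N arbitrary: i rule: inc_induct)
  case base
  show ?case
  proof (cases "i = 0")
    case False
    have "fps_cong W (euler_fps * gordon_fps n i W) (euler_fps * 1)"
      using False assms by (intro fps_cong_mult gordon_fps_limit fps_cong_refl) auto
    also have "fps_cong W (euler_fps * 1) (gordon_sum n W i W)"
      using gordon_sum_limit[of i n W] False base by (simp add: fps_cong_sym)
    finally show ?thesis .
  qed simp
next
  case (step N)
  from step.prems show ?case
  proof (induction i)
    case (Suc i)
    have "euler_fps * gordon_fps n (Suc i) N =
        euler_fps * gordon_fps n i N + fps_X ^ ((N + 1) * i) * (euler_fps * gordon_fps n (n - i) (Suc N))"
      using Suc.prems by (simp only: gordon_fps_Suc Suc_le_eq) (simp add: algebra_simps)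
    also have "fps_cong W \<dots> (gordon_sum n W i N + fps_X ^ ((N + 1) * i) * gordon_sum n W (n - i) (Suc N))"
      using Suc by (intro fps_cong_add fps_cong_mult fps_cong_refl step.IH) auto
    also have "fps_cong W \<dots> (gordon_sum n W (Suc i) N)"
      using Suc.prems by (intro fps_cong_sym[OF gordon_sum_rec]) auto
    finally show ?case .
  qed simp
qed

text \<open>For N = 0 and i = n the alternating sum is exactly the one in the triple
  product.\<close>

lemma euler_gordon_fps:
  assumes "n \<ge> 1"
  shows "euler_fps * gordon_fps n n 0 =
    prodinf (\<lambda>i. if i \<ge> 1 \<and> i mod (2 * n + 1) \<in> {0, n, n + 1} then 1 - fps_X ^ i else 1)"
proof (rule fps_cong_eqI)
  fix W
  have "fps_cong W (euler_fps * gordon_fps n n 0) (gordon_sum n W n 0)"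
    using assms by (intro euler_gordon_fps_cong) auto
  also have "gordon_sum n W n 0 =
      (\<Sum>p<W. (- 1) ^ p * fps_X ^ (n * p\<^sup>2 + (Suc p choose 2)) * (1 - fps_X ^ ((2 * p + 1) * n)))"
    by (simp add: gordon_sum_def)
  also have "fps_cong W \<dots> (prodinf (\<lambda>i. if i \<ge> 1 \<and> i mod (2 * n + 1) \<in> {0, n, n + 1} then 1 - fps_X ^ i else 1))"
    by (rule fps_cong_sym[OF jacobi_triple_product_cong[OF assms]])
  finally show "fps_cong W (euler_fps * gordon_fps n n 0)
    (prodinf (\<lambda>i. if i \<ge> 1 \<and> i mod (2 * n + 1) \<in> {0, n, n + 1} then 1 - fps_X ^ i else 1))" .
qed

lemma gordon_identity:
  assumes "n \<ge> 1"
  shows "gordon_fps n n 0 = prodinf (\<lambda>i. if i \<ge> 1 then inv_one_minus_X_power i else 1) *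
      prodinf (\<lambda>i. if i \<ge> 1 \<and> i mod (2 * n + 1) \<in> {0, n, n + 1} then 1 - fps_X ^ i else 1)" (is "_ = ?H * ?T")
    and "gordon_fps n n 0 = prodinf (\<lambda>i. if i \<ge> 1 \<and> i mod (2 * n + 1) \<notin> {0, n, n + 1}
                   then inv_one_minus_X_power i else 1)" (is "_ = ?R")
proof -
  have adic: "fps_cong (max 1 i) (if i \<ge> 1 \<and> Q i then inv_one_minus_X_power i else 1) 1"
      "fps_cong (max 1 i) (if i \<ge> 1 \<and> Q i then 1 - fps_X ^ i else 1) 1" for Q i
    by (auto simp: fps_cong_inv_one_minus_X_power fps_cong_one_minus_X_power max_def)
  have one: "prodinf (\<lambda>i. 1 :: int fps) = 1"
    using prodinf_fps_cong[of "\<lambda>_. 1"] by (intro fps_cong_eqI) force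
  have inv: "prodinf (\<lambda>i. if i \<ge> 1 \<and> Q i then inv_one_minus_X_power i else 1) *
      prodinf (\<lambda>i. if i \<ge> 1 \<and> Q i then 1 - fps_X ^ i else 1) = 1" for Q
  proof -
    have "(\<lambda>i. (if i \<ge> 1 \<and> Q i then inv_one_minus_X_power i else 1) *
        (if i \<ge> 1 \<and> Q i then 1 - fps_X ^ i else 1)) = (\<lambda>_. 1)"
      using inv_one_minus_X_power by (auto simp: fun_eq_iff mult.commute)
    with prodinf_fps_mult[OF adic(1)[of _ Q] adic(2)[of _ Q]] show ?thesis by (simp only: one)
  qed
  have HE: "?H * euler_fps = 1"
    using inv[of "\<lambda>_. True"] by (simp add: euler_fps_def)
  then have "gordon_fps n n 0 = ?H * (euler_fps * gordon_fps n n 0)"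
    by (simp add: mult.assoc[symmetric])
  then show 1: "gordon_fps n n 0 = ?H * ?T"
    by (simp only: euler_gordon_fps[OF assms])
  let ?C = "prodinf (\<lambda>i. if i \<ge> 1 \<and> i mod (2 * n + 1) \<notin> {0, n, n + 1} then 1 - fps_X ^ i else (1 :: int fps))"
  \<comment> \<open>For each i at least 1, exactly one of the two products contains the factor 1 -
    t^i.\<close>
  have TC: "?T * ?C = euler_fps"
    unfolding euler_fps_def
    by (subst prodinf_fps_mult[OF adic(2) adic(2)]) (rule arg_cong[of _ _ prodinf], auto simp: fun_eq_iff)
  have RC: "?R * ?C = 1" by (rule inv)
  have "?H * ?T = ?H * ?T * (?R * ?C)" by (simp only: RC mult_1_right)
  also have "\<dots> = ?H * (?T * ?C) * ?R" by (simp only: mult_ac)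
  finally have "?H * ?T = (?H * euler_fps) * ?R" by (simp only: TC)
  then show "gordon_fps n n 0 = ?R"
    by (simp only: 1 HE mult_1_left)
qed

section \<open>Functionals on the arc algebra\<close>

lemma lookup_single_mult_add:
  fixes p :: "'k::comm_ring_1 arc_poly"
  shows "Poly_Mapping.lookup (Poly_Mapping.single m c * p) (m + d) = c * Poly_Mapping.lookup p d"
proof -
  have "Poly_Mapping.lookup (Poly_Mapping.single m c * p) (m + d) =
      (\<Sum>l. (c * (\<Sum>q. Poly_Mapping.lookup p q when m + d = l + q)) when m = l)"
    by (simp add: lookup_mult lookup_single when_mult)
  also have "\<dots> = c * (\<Sum>q. Poly_Mapping.lookup p q when d = q)"
    by simp
  also have "\<dots> = c * Poly_Mapping.lookup p d"
    by simp
  finally show ?thesis .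
qed

lemma lookup_single_mult_eq_0:
  fixes p :: "'k::comm_ring_1 arc_poly"
  assumes "\<And>d. e \<noteq> m + d"
  shows "Poly_Mapping.lookup (Poly_Mapping.single m c * p) e = 0"
proof (rule ccontr)
  assume "Poly_Mapping.lookup (Poly_Mapping.single m c * p) e \<noteq> 0"
  then have "e \<in> Poly_Mapping.keys (Poly_Mapping.single m c * p)"
    by (simp add: in_keys_iff)
  with keys_mult[of "Poly_Mapping.single m c" p] assms show False
    by (auto split: if_splits)
qed

section \<open>The apolarity pairing\<close>

definition exponents :: "('a \<Rightarrow> nat) \<Rightarrow> 'a set \<Rightarrow> nat \<Rightarrow>\<^sub>0 nat"
  where "exponents d J = (\<Sum>j\<in>J. Poly_Mapping.single (d j) 1)"

definition fact_prod :: "(nat \<Rightarrow>\<^sub>0 nat) \<Rightarrow> nat"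
  where "fact_prod \<nu> = (\<Prod>i\<in>Poly_Mapping.keys \<nu>. fact (Poly_Mapping.lookup \<nu> i))"

text \<open>Apolarity: \<open>p\<close> with its variables replaced by partial derivatives is
  applied to the monomial \<open>exponents d J\<close> and evaluated at 0. Writing the monomial as a
  family of factors indexed by J makes a derivative a sum over removals of one j.\<close>

definition pairing :: "('a \<Rightarrow> nat) \<Rightarrow> 'a set \<Rightarrow> 'k::comm_ring_1 arc_poly \<Rightarrow> 'k"
  where "pairing d J p = of_nat (fact_prod (exponents d J)) * Poly_Mapping.lookup p (exponents d J)"

lemma pairing_0 [simp]: "pairing d J 0 = 0"
  by (simp add: pairing_def)

lemma pairing_add: "pairing d J (p + q) = pairing d J p + pairing d J q"
  by (simp add: pairing_def lookup_add distrib_left)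

lemma pairing_sum: "pairing d J (\<Sum>i\<in>A. f i) = (\<Sum>i\<in>A. pairing d J (f i))"
  by (induction A rule: infinite_finite_induct) (simp_all add: pairing_add)

lemma pairing_cong: "(\<And>j. j \<in> J \<Longrightarrow> d j = e j) \<Longrightarrow> pairing d J p = pairing e J p"
  unfolding pairing_def exponents_def by (simp cong: sum.cong)

lemma fact_prod_add_single:
  "fact_prod (\<nu> + Poly_Mapping.single a 1) = Suc (Poly_Mapping.lookup \<nu> a) * fact_prod \<nu>"
proof -
  have super: "fact_prod \<mu> = (\<Prod>i\<in>insert a (Poly_Mapping.keys \<nu>). fact (Poly_Mapping.lookup \<mu> i))"
    if "Poly_Mapping.keys \<mu> \<subseteq> insert a (Poly_Mapping.keys \<nu>)" for \<mu>
    unfolding fact_prod_def using that by (intro prod.mono_neutral_left) (auto simp: in_keys_iff)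
  have "fact_prod (\<nu> + Poly_Mapping.single a 1) =
      (\<Prod>i\<in>insert a (Poly_Mapping.keys \<nu>). fact (Poly_Mapping.lookup (\<nu> + Poly_Mapping.single a 1) i))"
    using keys_add[of \<nu> "Poly_Mapping.single a (1::nat)"] by (intro super) auto
  also have "\<dots> = fact (Suc (Poly_Mapping.lookup \<nu> a)) *
      (\<Prod>i\<in>Poly_Mapping.keys \<nu> - {a}. fact (Poly_Mapping.lookup \<nu> i))"
    by (subst prod.insert_remove) (auto simp: lookup_add lookup_single when_def intro!: prod.cong)
  also have "\<dots> = Suc (Poly_Mapping.lookup \<nu> a) * fact_prod \<nu>"
    by (subst super) (auto simp: prod.insert_remove algebra_simps)
  finally show ?thesis .
qed

lemma lookup_exponents:
  "finite J \<Longrightarrow> Poly_Mapping.lookup (exponents d J) a = card {j \<in> J. d j = a}"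
  unfolding exponents_def by (simp add: lookup_sum lookup_single when_def flip: sum.inter_filter)

lemma exponents_remove:
  "finite J \<Longrightarrow> j \<in> J \<Longrightarrow> exponents d J = exponents d (J - {j}) + Poly_Mapping.single (d j) 1"
  unfolding exponents_def by (simp add: sum.remove add.commute)

text \<open>The variable with index \<open>a\<close> acts under the pairing as the derivation \<open>\<partial>/\<partial>Y\<^sub>a\<close> on the monomial
  \<open>\<Prod>\<^sub>j Y\<^bsub>d j\<^esub>\<close>.\<close>

lemma pairing_var_mult:
  fixes p :: "'k::comm_ring_1 arc_poly"
  assumes "finite J"
  shows "pairing d J (Poly_Mapping.single (Poly_Mapping.single a 1) 1 * p) =
    (\<Sum>j | j \<in> J \<and> d j = a. pairing d (J - {j}) p)"
proof (cases "\<exists>j\<in>J. d j = a")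
  case True
  then obtain i where i: "i \<in> J" "d i = a" by blast
  define \<nu> where "\<nu> = exponents d (J - {i})"
  have rm: "exponents d (J - {j}) = \<nu>" if "j \<in> J" "d j = a" for j
    using exponents_remove[OF assms that(1), of d] exponents_remove[OF assms i(1), of d] that i
    by (simp add: \<nu>_def)
  have J: "exponents d J = \<nu> + Poly_Mapping.single a 1"
    using exponents_remove[OF assms i(1), of d] i by (simp add: \<nu>_def)
  have "card {j \<in> J. d j = a} = Suc (Poly_Mapping.lookup \<nu> a)"
    unfolding lookup_exponents[OF assms, symmetric] J by (simp add: lookup_add)
  moreover have "(\<Sum>j | j \<in> J \<and> d j = a. pairing d (J - {j}) p) =
      (\<Sum>j | j \<in> J \<and> d j = a. of_nat (fact_prod \<nu>) * Poly_Mapping.lookup p \<nu>)"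
    by (intro sum.cong) (auto simp: pairing_def rm)
  moreover have "Poly_Mapping.lookup (Poly_Mapping.single (Poly_Mapping.single a 1) 1 * p)
      (\<nu> + Poly_Mapping.single a 1) = Poly_Mapping.lookup p \<nu>"
    by (subst add.commute) (simp add: lookup_single_mult_add)
  ultimately show ?thesis
    unfolding pairing_def J fact_prod_add_single by (simp add: algebra_simps)
next
  case False
  then have empty: "{j \<in> J. d j = a} = {}" by auto
  have "exponents d J \<noteq> Poly_Mapping.single a 1 + e" for e
  proof
    assume "exponents d J = Poly_Mapping.single a 1 + e"
    from arg_cong[OF this, of "\<lambda>\<nu>. Poly_Mapping.lookup \<nu> a"] show False
      by (simp only: lookup_exponents[OF assms] empty lookup_add) simp
  qed
  then have "Poly_Mapping.lookup (Poly_Mapping.single (Poly_Mapping.single a 1) 1 * p) (exponents d J) = 0"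
    by (rule lookup_single_mult_eq_0)
  then show ?thesis by (simp only: pairing_def empty mult_zero_right sum.empty)
qed

text \<open>One factor \<open>generic_arc\<close> acts as the derivation that removes any j and
  records its weight; this weight is \<open>Suc (d j)\<close> because variable indices start at
  0.\<close>

lemma pairing_power_Suc:
  fixes p :: "'k::comm_ring_1 arc_poly"
  assumes "finite J"
  shows "pairing d J ((generic_arc ^ Suc n) $ l * p) =
    (\<Sum>j | j \<in> J \<and> Suc (d j) \<le> l. pairing d (J - {j}) ((generic_arc ^ n) $ (l - Suc (d j)) * p))"
proof -
  define f where "f i j = pairing d (J - {j}) ((generic_arc ^ n) $ (l - i) * p)" for i j
  have "pairing d J ((generic_arc ^ Suc n) $ l * p) =
      (\<Sum>i\<in>{0..l}. pairing d J (generic_arc $ i * ((generic_arc ^ n) $ (l - i) * p)))"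
    by (simp add: fps_mult_nth sum_distrib_right pairing_sum mult.assoc)
  also have "\<dots> = (\<Sum>i\<in>{1..l}. pairing d J (generic_arc $ i * ((generic_arc ^ n) $ (l - i) * p)))"
    by (intro sum.mono_neutral_right) (auto simp: generic_arc_def)
  also have "\<dots> = (\<Sum>i\<in>{1..l}. \<Sum>j | j \<in> J \<and> d j = i - 1. f i j)"
    by (intro sum.cong refl) (auto simp: generic_arc_def arc_var_def pairing_var_mult[OF assms] f_def
        simp del: One_nat_def)
  also have "\<dots> = (\<Sum>i\<in>{1..l}. \<Sum>j | j \<in> J. if d j = i - 1 then f i j else 0)"
    using assms by (simp add: sum.inter_filter)
  also have "\<dots> = (\<Sum>j\<in>J. \<Sum>i\<in>{1..l}. if d j = i - 1 then f i j else 0)"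
    by (subst sum.swap) simp
  also have "\<dots> = (\<Sum>j\<in>J. \<Sum>i\<in>{1..l}. if i = Suc (d j) then f (Suc (d j)) j else 0)"
    by (intro sum.cong refl) auto
  also have "\<dots> = (\<Sum>j\<in>J. if Suc (d j) \<le> l then f (Suc (d j)) j else 0)"
    by (intro sum.cong refl) (simp add: sum.delta)
  finally show ?thesis
    using assms unfolding f_def by (simp add: sum.inter_filter)
qed

definition dlists :: "'a set \<Rightarrow> nat \<Rightarrow> 'a list set"
  where "dlists J n = {js. distinct js \<and> length js = n \<and> set js \<subseteq> J}"

lemma dlists_0: "dlists J 0 = {[]}"
  by (auto simp: dlists_def)

lemma finite_dlists: "finite J \<Longrightarrow> finite (dlists J n)"
  by (rule finite_subset[OF _ finite_lists_length_eq[of J n]]) (auto simp: dlists_def)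

lemma sum_dlists_Suc:
  assumes "finite J"
  shows "(\<Sum>js\<in>dlists J (Suc n). f js) = (\<Sum>j\<in>J. \<Sum>js\<in>dlists (J - {j}) n. f (j # js))"
proof -
  have "(\<Sum>j\<in>J. \<Sum>js\<in>dlists (J - {j}) n. f (j # js)) =
      (\<Sum>(j, js)\<in>(SIGMA j:J. dlists (J - {j}) n). f (j # js))"
    using assms by (intro sum.Sigma) (auto simp: finite_dlists)
  also have "\<dots> = (\<Sum>js\<in>dlists J (Suc n). f js)"
  proof (rule sum.reindex_bij_witness[of _ "\<lambda>js. (hd js, tl js)" "\<lambda>(j, js). j # js"])
    fix js assume "js \<in> dlists J (Suc n)"
    then show "(case (hd js, tl js) of (j, js) \<Rightarrow> j # js) = js"
      and "(hd js, tl js) \<in> (SIGMA j:J. dlists (J - {j}) n)"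
      by (cases js; auto simp: dlists_def)+
  qed (auto simp: dlists_def)
  finally show ?thesis ..
qed

text \<open>Iterating the derivation removes n distinct factors one after another, in every order; l
  is the total weight removed.\<close>

lemma pairing_power:
  fixes p :: "'k::comm_ring_1 arc_poly"
  assumes "finite J"
  shows "pairing d J ((generic_arc ^ n) $ l * p) =
    (\<Sum>js\<in>dlists J n. if (\<Sum>j\<leftarrow>js. Suc (d j)) = l then pairing d (J - set js) p else 0)"
  using assms
proof (induction n arbitrary: J l)
  case (Suc n)
  have "pairing d J ((generic_arc ^ Suc n) $ l * p) =
      (\<Sum>j\<in>J. if Suc (d j) \<le> l then pairing d (J - {j}) ((generic_arc ^ n) $ (l - Suc (d j)) * p) else 0)"
    unfolding pairing_power_Suc[OF Suc.prems] using Suc.prems by (simp add: sum.inter_filter)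
  also have "\<dots> = (\<Sum>j\<in>J. \<Sum>js\<in>dlists (J - {j}) n.
      if (\<Sum>i\<leftarrow>j # js. Suc (d i)) = l then pairing d (J - set (j # js)) p else 0)"
  proof (intro sum.cong refl)
    fix j assume "j \<in> J"
    show "(if Suc (d j) \<le> l then pairing d (J - {j}) ((generic_arc ^ n) $ (l - Suc (d j)) * p) else 0) =
      (\<Sum>js\<in>dlists (J - {j}) n.
        if (\<Sum>i\<leftarrow>j # js. Suc (d i)) = l then pairing d (J - set (j # js)) p else 0)"
    proof (cases "Suc (d j) \<le> l")
      case True
      then have "(\<Sum>i\<leftarrow>j # js. Suc (d i)) = l \<longleftrightarrow> (\<Sum>i\<leftarrow>js. Suc (d i)) = l - Suc (d j)" for js
        by auto
      then show ?thesis
        using True Suc.IH[of "J - {j}" "l - Suc (d j)"] Suc.prems by (simp add: Diff_insert2[symmetric] cong: if_cong)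
    qed (auto intro!: sum.neutral)
  qed
  finally show ?case
    by (simp only: sum_dlists_Suc[OF Suc.prems])
qed (simp add: dlists_0)


section \<open>Products of determinants over residue classes\<close>

definition class_perms :: "nat \<Rightarrow> nat \<Rightarrow> (nat \<Rightarrow> nat) set"
  where "class_perms m r = {\<rho>. \<rho> permutes {..<m} \<and> (\<forall>j. \<rho> j mod r = j mod r)}"

lemma finite_class_perms: "finite (class_perms m r)"
  by (rule finite_subset[OF _ finite_permutations[of "{..<m}"]]) (auto simp: class_perms_def)

lemma id_in_class_perms: "id \<in> class_perms m r"
  by (simp add: class_perms_def permutes_id)

lemma comp_transpose_in_class_perms:
  assumes "\<rho> \<in> class_perms m r" "i < m" "j < m" "i mod r = j mod r"
  shows "\<rho> \<circ> Transposition.transpose i j \<in> class_perms m r"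
  using assms unfolding class_perms_def
  by (auto intro!: permutes_compose permutes_swap_id simp: Transposition.transpose_def)

text \<open>Expanding the determinants, this is the pairing with the product over the residue classes \<open>c\<close>
  modulo \<open>r\<close> of \<open>det (Y\<^bsub>s i + t j\<^esub>)\<close> with \<open>i\<close> and \<open>j\<close> in \<open>c\<close>.\<close>

definition det_functional :: "nat \<Rightarrow> nat \<Rightarrow> (nat \<Rightarrow> nat) \<Rightarrow> (nat \<Rightarrow> nat) \<Rightarrow> 'k::comm_ring_1 arc_poly \<Rightarrow> 'k"
  where "det_functional m r s t p =
    (\<Sum>\<rho>\<in>class_perms m r. of_int (sign \<rho>) * pairing (\<lambda>j. s j + t (\<rho> j)) {..<m} p)"

lemma det_functional_sum: "det_functional m r s t (\<Sum>i\<in>A. f i) = (\<Sum>i\<in>A. det_functional m r s t (f i))"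
  unfolding det_functional_def by (simp add: pairing_sum sum_distrib_left) (rule sum.swap)

text \<open>Among \<open>n > r\<close> indices two lie in the same class, and exchanging their columns changes the sign.\<close>

lemma det_functional_arc_eqn:
  fixes p :: "'k::field_char_0 arc_poly"
  assumes "r < n" "r \<ge> 1"
  shows "det_functional m r s t (arc_eqn n l * p) = 0"
proof -
  define f where "f \<rho> js = (of_int (sign \<rho>) * (if (\<Sum>j\<leftarrow>js. Suc (s j + t (\<rho> j))) = l
      then pairing (\<lambda>j. s j + t (\<rho> j)) ({..<m} - set js) p else 0) :: 'k)" for \<rho> js
  have "(\<Sum>\<rho>\<in>class_perms m r. f \<rho> js) = 0" if js: "js \<in> dlists {..<m} n" for js
  proof -
    have "\<not> inj_on (\<lambda>j. j mod r) (set js)"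
    proof
      assume inj: "inj_on (\<lambda>j. j mod r) (set js)"
      have "card (set js) = card ((\<lambda>j. j mod r) ` set js)" using inj by (simp add: card_image)
      also have "\<dots> \<le> card {..<r}" using assms by (intro card_mono) auto
      finally show False using js assms by (auto simp: dlists_def distinct_card)
    qed
    then obtain i j where ij: "i \<in> set js" "j \<in> set js" "i \<noteq> j" "i mod r = j mod r"
      unfolding inj_on_def by blast
    define \<tau> where "\<tau> = Transposition.transpose i j"
    have \<tau>: "\<tau> permutes set js" "\<tau> \<circ> \<tau> = id" "permutation \<tau>" "sign \<tau> = - 1"
      using ij by (auto simp: \<tau>_def permutes_swap_id sign_swap_id permutation_swap_id)
    have bound: "i < m" "j < m" and dist: "distinct js" using js ij by (auto simp: dlists_def)
    \<comment> \<open>\<open>\<tau>\<close> permutes only removed indices. It therefore changes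
      neither the removed weight nor the remaining factors, but it reverses the sign.\<close>
    have flip: "f (\<rho> \<circ> \<tau>) js = - f \<rho> js" if \<rho>: "\<rho> \<in> class_perms m r" for \<rho>
    proof -
      have "permutation \<rho>" using \<rho> permutation_permutes by (auto simp: class_perms_def)
      then have "sign (\<rho> \<circ> \<tau>) = - sign \<rho>" using \<tau> by (simp add: sign_compose)
      moreover have "(\<Sum>x\<leftarrow>js. Suc (s x + t ((\<rho> \<circ> \<tau>) x))) = (\<Sum>x\<leftarrow>js. Suc (s x + t (\<rho> x)))"
      proof -
        have "(\<Sum>x\<in>set js. t (\<rho> (\<tau> x))) = (\<Sum>x\<in>set js. t (\<rho> x))"
          using sum.permute[OF \<tau>(1), of "\<lambda>x. t (\<rho> x)"] by (simp add: o_def)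
        then show ?thesis
          using dist by (simp add: sum_list_distinct_conv_sum_set sum.distrib sum_Suc)
      qed
      moreover have "pairing (\<lambda>x. s x + t ((\<rho> \<circ> \<tau>) x)) ({..<m} - set js) p =
          pairing (\<lambda>x. s x + t (\<rho> x)) ({..<m} - set js) p"
        using \<tau>(1) by (intro pairing_cong) (auto simp: permutes_not_in)
      ultimately show ?thesis by (simp only: f_def of_int_minus mult_minus_left)
    qed
    \<comment> \<open>Composition with \<open>\<tau>\<close> is an involution of the index set, so
      the sum equals its own negative, and the characteristic is 0.\<close>
    have "(\<Sum>\<rho>\<in>class_perms m r. f \<rho> js) = (\<Sum>\<rho>\<in>class_perms m r. f (\<rho> \<circ> \<tau>) js)"
    proof -
      have "\<rho> \<circ> \<tau> \<in> class_perms m r" if "\<rho> \<in> class_perms m r" for \<rho>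
        using comp_transpose_in_class_perms[OF that bound] ij by (simp add: \<tau>_def)
      then show ?thesis
        by (intro sum.reindex_bij_witness[of _ "\<lambda>\<rho>. \<rho> \<circ> \<tau>" "\<lambda>\<rho>. \<rho> \<circ> \<tau>"]) (simp_all add: comp_assoc \<tau>(2))
    qed
    also have "\<dots> = - (\<Sum>\<rho>\<in>class_perms m r. f \<rho> js)"
      by (simp add: flip sum_negf)
    finally show ?thesis by simp
  qed
  then have "(\<Sum>js\<in>dlists {..<m} n. \<Sum>\<rho>\<in>class_perms m r. f \<rho> js) = 0"
    by (intro sum.neutral) blast
  moreover have "det_functional m r s t (arc_eqn n l * p) =
      (\<Sum>\<rho>\<in>class_perms m r. \<Sum>js\<in>dlists {..<m} n. f \<rho> js)"
    unfolding det_functional_def arc_eqn_def f_def by (simp only: pairing_power finite_lessThan sum_distrib_left)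
  ultimately show ?thesis
    by (simp only: sum.swap[of _ "class_perms m r"])
qed

section \<open>From the equations to the arc ideal\<close>

lemma arc_ideal_subset:
  assumes "\<And>l. l \<ge> 1 \<Longrightarrow> arc_eqn n l \<in> J" "0 \<in> J" "\<And>p q. p \<in> J \<Longrightarrow> q \<in> J \<Longrightarrow> p + q \<in> J"
    and "\<And>p q. p \<in> J \<Longrightarrow> q * p \<in> J"
  shows "(arc_ideal n :: 'k::comm_ring_1 arc_poly set) \<subseteq> J"
proof -
  interpret P: ring "ring_of_type_algebra :: 'k arc_poly ring" by (rule ring_from_type_algebra)
  have inv: "\<ominus>\<^bsub>ring_of_type_algebra\<^esub> p = - p" for p :: "'k arc_poly"
    by (rule P.minus_equality) (auto simp: ring_of_type_algebra_def)
  have "- p \<in> J" if "p \<in> J" for p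
    using assms(4)[OF that, of "- 1"] by simp
  then have "ideal J (ring_of_type_algebra :: 'k arc_poly ring)"
    using assms inv
    by (intro idealI P.add.subgroupI)
      (auto simp: ring_of_type_algebra_def a_inv_def mult.commute intro: P.ring_axioms[unfolded ring_of_type_algebra_def])
  then show ?thesis
    unfolding arc_ideal_def using assms(1) by (intro P.genideal_minimal) auto
qed

lemma arc_ideal_closed:
  fixes p q :: "'k::comm_ring_1 arc_poly"
  shows "(0 :: 'k arc_poly) \<in> arc_ideal n"
    and "p \<in> arc_ideal n \<Longrightarrow> q \<in> arc_ideal n \<Longrightarrow> p + q \<in> arc_ideal n"
    and "p \<in> arc_ideal n \<Longrightarrow> q * p \<in> arc_ideal n"
    and "l \<ge> 1 \<Longrightarrow> (arc_eqn n l :: 'k arc_poly) \<in> arc_ideal n"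
proof -
  interpret P: ring "ring_of_type_algebra :: 'k arc_poly ring" by (rule ring_from_type_algebra)
  interpret I: ideal "arc_ideal n" "ring_of_type_algebra :: 'k arc_poly ring" by (rule ideal_arc_ideal)
  show "(0 :: 'k arc_poly) \<in> arc_ideal n"
    using I.zero_closed by (simp add: ring_of_type_algebra_def)
  show "p + q \<in> arc_ideal n" if "p \<in> arc_ideal n" "q \<in> arc_ideal n"
    using I.a_closed[OF that] by (simp add: ring_of_type_algebra_def)
  show "q * p \<in> arc_ideal n" if "p \<in> arc_ideal n"
    using I.I_l_closed[OF that, of q] by (simp add: ring_of_type_algebra_def)
  show "(arc_eqn n l :: 'k arc_poly) \<in> arc_ideal n" if "l \<ge> 1"
    using P.genideal_self[of "{arc_eqn n l |l. l \<ge> 1}"] that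
    by (auto simp: arc_ideal_def ring_of_type_algebra_def)
qed

lemma det_functional_arc_ideal:
  fixes p :: "'k::field_char_0 arc_poly"
  assumes "r < n" "r \<ge> 1" "p \<in> arc_ideal n"
  shows "det_functional m r s t p = 0"
proof -
  \<comment> \<open>Asking for vanishing on all multiples makes \<open>J\<close> an ideal; the
    kernel of the functional alone need not be one.\<close>
  define J where "J = {p :: 'k arc_poly. \<forall>q. det_functional m r s t (q * p) = 0}"
  have add: "det_functional m r s t (p + q) = det_functional m r s t p + det_functional m r s t q" for p q :: "'k arc_poly"
    by (simp add: det_functional_def pairing_add distrib_left sum.distrib)
  have "det_functional m r s t (0 :: 'k arc_poly) = 0"
    by (simp add: det_functional_def)
  then have "arc_ideal n \<subseteq> J"
    using det_functional_arc_eqn[OF assms(1,2)]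
    by (intro arc_ideal_subset) (auto simp: J_def distrib_left add mult.commute[of _ "arc_eqn n _"] simp flip: mult.assoc)
  then have "p \<in> J" using assms(3) by blast
  then have "det_functional m r s t (1 * p) = 0" unfolding J_def by blast
  then show ?thesis by simp
qed

section \<open>Triangularity by rearrangement\<close>

lemma class_perms_moved:
  assumes "\<rho> \<in> class_perms m r" "\<rho> \<noteq> id"
  obtains i j where "i < j" "j < m" "\<rho> j = i" "i < \<rho> i" "\<rho> i < m" "i mod r = j mod r" "i mod r = \<rho> i mod r"
proof -
  have perm: "\<rho> permutes {..<m}" and cls: "\<rho> x mod r = x mod r" for x
    using assms by (auto simp: class_perms_def)
  \<comment> \<open>All points below the least moved point are fixed, so both its image and its
    preimage lie above it.\<close>
  define i where "i = (LEAST x. \<rho> x \<noteq> x)"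
  obtain x where "\<rho> x \<noteq> x" using assms(2) by (auto simp: fun_eq_iff)
  then have i: "\<rho> i \<noteq> i" unfolding i_def by (rule LeastI)
  have small: "\<rho> x = x" if "x < i" for x
    using not_less_Least[OF that[unfolded i_def]] by blast
  obtain j where j: "\<rho> j = i" using permutes_surj[OF perm] by (metis surjD)
  have inj: "\<rho> a = \<rho> b \<Longrightarrow> a = b" for a b using permutes_inj[OF perm] by (auto dest: injD)
  have "i < \<rho> i"
    using i small[of "\<rho> i"] inj by (metis linorder_neqE_nat)
  moreover have "i < j"
    using i j small[of j] by (metis linorder_neqE_nat)
  moreover have "j < m" "\<rho> i < m"
    using permutes_not_in[OF perm, of j] permutes_not_in[OF perm, of i] permutes_in_image[OF perm, of i] i j
      \<open>i < j\<close> by auto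
  ultimately show ?thesis
    using that j cls[of i] cls[of j] by simp
qed

text \<open>For \<open>\<rho>\<close> other than the identity, letting the least moved point i and
  its preimage exchange their values strictly increases the sum. On the finite set of permutations
  only the identity can then be maximal.\<close>

lemma class_perms_rearrangement:
  assumes mono: "\<And>i j. i < j \<Longrightarrow> j < m \<Longrightarrow> i mod r = j mod r \<Longrightarrow> s i < s j \<and> t i < t j"
    and \<rho>: "\<rho> \<in> class_perms m r" "\<rho> \<noteq> id"
  shows "(\<Sum>j<m. s j * t (\<rho> j)) < (\<Sum>j<m. s j * t j :: nat)"
proof -
  define V where "V \<rho> = (\<Sum>j<m. s j * t (\<rho> j))" for \<rho>
  have improve: "\<exists>\<rho>'\<in>class_perms m r. V \<rho> < V \<rho>'" if \<rho>: "\<rho> \<in> class_perms m r" "\<rho> \<noteq> id" for \<rho>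
  proof -
    obtain i j where ij: "i < j" "j < m" "\<rho> j = i" "i < \<rho> i" "\<rho> i < m" "i mod r = j mod r" "i mod r = \<rho> i mod r"
      using class_perms_moved[OF \<rho>] .
    define \<tau> where "\<tau> = Transposition.transpose i j"
    have split: "(\<Sum>x<m. f x) = f i + f j + (\<Sum>x\<in>{..<m} - {i} - {j}. f x)" for f :: "nat \<Rightarrow> nat"
      using ij by (simp add: sum.remove[of "{..<m}" i] sum.remove[of "{..<m} - {i}" j])
    have rest: "(\<Sum>x\<in>{..<m} - {i} - {j}. s x * t ((\<rho> \<circ> \<tau>) x)) = (\<Sum>x\<in>{..<m} - {i} - {j}. s x * t (\<rho> x))"
      by (intro sum.cong) (auto simp: \<tau>_def)
    have st: "s i < s j" "t i < t (\<rho> i)"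
      using mono[of i j] mono[of i "\<rho> i"] ij by auto
    then obtain a b where "s j = s i + Suc a" "t (\<rho> i) = t i + Suc b"
      by (metis add_Suc_right less_imp_Suc_add)
    then have "s i * t (\<rho> i) + s j * t i < s i * t i + s j * t (\<rho> i)"
      by (simp add: algebra_simps)
    then have "V \<rho> < V (\<rho> \<circ> \<tau>)"
      unfolding V_def split rest using ij by (simp add: \<tau>_def)
    moreover have "\<rho> \<circ> \<tau> \<in> class_perms m r"
      unfolding \<tau>_def using ij \<rho> by (intro comp_transpose_in_class_perms) auto
    ultimately show ?thesis by blast
  qed
  have fin: "finite (V ` class_perms m r)" "V ` class_perms m r \<noteq> {}"
    using finite_class_perms[of m r] id_in_class_perms[of m r] by auto
  obtain \<rho>' where \<rho>': "\<rho>' \<in> class_perms m r" "V \<rho>' = Max (V ` class_perms m r)"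
    using Max_in[OF fin] by auto
  then have max: "V \<pi> \<le> V \<rho>'" if "\<pi> \<in> class_perms m r" for \<pi>
    using fin that by simp
  have "\<rho>' = id"
    using improve[OF \<rho>'(1)] max by (meson not_le)
  moreover obtain \<pi> where "\<pi> \<in> class_perms m r" "V \<rho> < V \<pi>"
    using improve[OF \<rho>] by blast
  ultimately have "V \<rho> < V id" using max by (meson less_le_trans)
  then show ?thesis by (simp add: V_def)
qed

text \<open>The value Q of the term of \<open>\<rho>\<close> is a constant plus twice the sum of s j
  * t (\<open>\<rho>\<close> j), so the diagonal is the unique term with maximal Q. Its coefficient
  in the functional is the product of the factorials of the exponents.\<close>

lemma det_functional_single:
  fixes c :: "'k::field_char_0"
  assumes mono: "\<And>i j. i < j \<Longrightarrow> j < m \<Longrightarrow> i mod r = j mod r \<Longrightarrow> s i < s j \<and> t i < t j"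
    and \<mu>: "\<mu> = exponents (\<lambda>j. s j + t j) {..<m}"
  shows "det_functional m r s t (Poly_Mapping.single \<mu> c) = of_nat (fact_prod \<mu>) * c"
    and "\<nu> \<noteq> \<mu> \<Longrightarrow> mon_sum (\<lambda>i. i\<^sup>2) \<mu> \<le> mon_sum (\<lambda>i. i\<^sup>2) \<nu> \<Longrightarrow>
      det_functional m r s t (Poly_Mapping.single \<nu> c) = 0"
proof -
  let ?Q = "mon_sum (\<lambda>i. i\<^sup>2)"
  let ?D = "\<lambda>\<rho>. exponents (\<lambda>j. s j + t (\<rho> j)) {..<m}"
  have less: "?Q (?D \<rho>) < ?Q \<mu>" if \<rho>: "\<rho> \<in> class_perms m r" "\<rho> \<noteq> id" for \<rho>
  proof -
    have Q: "?Q (?D \<rho>) = (\<Sum>j<m. (s j)\<^sup>2) + (\<Sum>j<m. (t j)\<^sup>2) + 2 * (\<Sum>j<m. s j * t (\<rho> j))"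
      if "\<rho> \<in> class_perms m r" for \<rho>
    proof -
      have "\<rho> permutes {..<m}" using that by (simp add: class_perms_def)
      from sum.permute[OF this, of "\<lambda>j. (t j)\<^sup>2"] show ?thesis
        by (simp add: exponents_def mon_sum_sum power2_sum sum.distrib sum_distrib_left mult.assoc o_def)
    qed
    show ?thesis
      using Q[OF \<rho>(1)] Q[OF id_in_class_perms] class_perms_rearrangement[OF mono \<rho>] by (simp add: \<mu>)
  qed
  have val: "pairing (\<lambda>j. s j + t (\<rho> j)) {..<m} (Poly_Mapping.single \<nu> c) =
      (if ?D \<rho> = \<nu> then of_nat (fact_prod \<nu>) * c else 0)" for \<rho> \<nu>
    by (simp add: pairing_def lookup_single when_def)
  have "det_functional m r s t (Poly_Mapping.single \<mu> c) =
      (\<Sum>\<rho>\<in>{id}. of_int (sign \<rho>) * pairing (\<lambda>j. s j + t (\<rho> j)) {..<m} (Poly_Mapping.single \<mu> c))"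
    unfolding det_functional_def
  proof (intro sum.mono_neutral_right finite_class_perms ballI)
    fix \<rho> assume "\<rho> \<in> class_perms m r - {id}"
    then have "?D \<rho> \<noteq> \<mu>" using less[of \<rho>] by auto
    then show "of_int (sign \<rho>) * pairing (\<lambda>j. s j + t (\<rho> j)) {..<m} (Poly_Mapping.single \<mu> c) = 0"
      by (simp add: val)
  qed (simp add: id_in_class_perms)
  also have "\<dots> = of_nat (fact_prod \<mu>) * c"
    by (simp add: val \<mu>)
  finally show "det_functional m r s t (Poly_Mapping.single \<mu> c) = of_nat (fact_prod \<mu>) * c" .
  assume \<nu>: "\<nu> \<noteq> \<mu>" "?Q \<mu> \<le> ?Q \<nu>"
  have "?D \<rho> \<noteq> \<nu>" if "\<rho> \<in> class_perms m r" for \<rho>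
    using less[OF that] \<nu> by (cases "\<rho> = id") (auto simp: \<mu>)
  then show "det_functional m r s t (Poly_Mapping.single \<nu> c) = 0"
    unfolding det_functional_def by (intro sum.neutral) (auto simp: val)
qed

section \<open>Standard monomials as diagonals\<close>

lemma ex_sorted_exponents:
  obtains xs where "sorted xs" "\<nu> = exponents (\<lambda>j. xs ! j) {..<length xs}"
proof -
  let ?P = "\<lambda>xs. \<Sum>x\<leftarrow>xs. Poly_Mapping.single x (1::nat)"
  have "\<exists>xs. \<nu> = ?P xs"
  proof (induction \<nu> rule: update_induct)
    case const
    show ?case by (intro exI[of _ "[]"]) simp
  next
    case (update \<nu> a b)
    then obtain xs where xs: "\<nu> = ?P xs" by blast
    have rep: "?P (replicate b a) = Poly_Mapping.single a b" for b
      by (induction b) (simp_all flip: single_add)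
    have "Poly_Mapping.update a b \<nu> = Poly_Mapping.single a b + \<nu>"
      using update by (intro poly_mapping_eqI) (auto simp: lookup_update lookup_add lookup_single when_def in_keys_iff)
    then have "Poly_Mapping.update a b \<nu> = ?P (replicate b a) + ?P xs"
      by (simp only: rep xs)
    then have "Poly_Mapping.update a b \<nu> = ?P (replicate b a @ xs)"
      by (simp only: map_append sum_list_append)
    then show ?case by blast
  qed
  then obtain xs where xs: "\<nu> = ?P xs" by blast
  have "?P xs = ?P (sort xs)"
    by (simp only: mset_sort mset_map sum_mset_sum_list[symmetric])
  also have "\<dots> = exponents (\<lambda>j. sort xs ! j) {..<length (sort xs)}"
    by (simp add: sum_list_sum_nth exponents_def lessThan_atLeast0)
  finally show ?thesis
    using that[of "sort xs"] xs by simp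
qed

text \<open>Otherwise n consecutive entries of the sorted list take only the values a and a + 1, and
  the exponents at these two indices sum to at least n.\<close>

lemma gordon_mons_gap:
  assumes "\<nu> \<in> gordon_mons n n 0" "n \<ge> 2" "sorted xs" "\<nu> = exponents (\<lambda>j. xs ! j) {..<length xs}"
    and "j + (n - 1) < length xs"
  shows "xs ! j + 2 \<le> xs ! (j + (n - 1))"
proof (rule ccontr)
  assume neg: "\<not> ?thesis"
  define a where "a = xs ! j"
  have range: "xs ! i = a \<or> xs ! i = Suc a" if "i \<in> {j..j + (n - 1)}" for i
  proof -
    have "xs ! j \<le> xs ! i" "xs ! i \<le> xs ! (j + (n - 1))"
      using that assms by (auto intro!: sorted_nth_mono)
    then show ?thesis using neg by (auto simp: a_def)
  qed
  let ?A = "\<lambda>b. {i \<in> {..<length xs}. xs ! i = b}"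
  have "card {j..j + (n - 1)} \<le> card (?A a \<union> ?A (Suc a))"
    using range assms by (intro card_mono) force+
  also have "\<dots> \<le> card (?A a) + card (?A (Suc a))" by (rule card_Un_le)
  also have "\<dots> = Poly_Mapping.lookup \<nu> a + Poly_Mapping.lookup \<nu> (Suc a)"
    by (simp add: assms(4) lookup_exponents)
  also have "\<dots> < n" using assms(1) by (simp add: gordon_mons_def)
  finally show False using assms(2) by simp
qed

text \<open>The \<open>j\<close>-th smallest variable index is assigned to the residue class of \<open>j\<close> modulo \<open>n - 1\<close>; within a
  class the indices then have gaps at least \<open>2\<close>, so that they split as \<open>s + t\<close> with both summands increasing.\<close>

lemma gordon_mons_split:
  assumes "\<nu> \<in> gordon_mons n n 0" "n \<ge> 2"
  obtains m s t where "\<nu> = exponents (\<lambda>j. s j + t j) {..<m}"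
    "\<And>i j. i < j \<Longrightarrow> j < m \<Longrightarrow> i mod (n - 1) = j mod (n - 1) \<Longrightarrow> s i < s j \<and> t i < t j"
proof -
  obtain xs where xs: "sorted xs" "\<nu> = exponents (\<lambda>j. xs ! j) {..<length xs}"
    using ex_sorted_exponents .
  define m r where "m = length xs" and "r = n - 1"
  \<comment> \<open>The position of j within its residue class. It grows by 1 per step while the
    entry grows by at least 2, so the remainder \<open>xs ! j - s j\<close> grows too.\<close>
  define s where "s j = j div r" for j
  have gap: "xs ! i + 2 * k \<le> xs ! (i + k * r)" if "i + k * r < m" for i k
    using that
  proof (induction k)
    case (Suc k)
    have eq: "i + Suc k * r = (i + k * r) + r" by simp
    have "xs ! i + 2 * k \<le> xs ! (i + k * r)" using Suc by simp
    moreover have "xs ! (i + k * r) + 2 \<le> xs ! ((i + k * r) + r)"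
      using gordon_mons_gap[OF assms xs, of "i + k * r", folded r_def m_def] Suc.prems by (simp only: eq)
    ultimately show ?case unfolding eq by simp
  qed simp
  have gap': "xs ! i + 2 * (s j - s i) \<le> xs ! j" if "i < j" "j < m" "i mod r = j mod r" for i j
  proof -
    have "s i \<le> s j" using that by (simp add: s_def div_le_mono)
    moreover have "i = s i * r + j mod r" "j = s j * r + j mod r"
      using that(3) by (metis s_def div_mult_mod_eq)+
    ultimately have "j = i + (s j - s i) * r"
      by (metis add.assoc add.commute diff_mult_distrib le_add_diff_inverse mult_le_mono1)
    then show ?thesis using gap[of i "s j - s i"] that by simp
  qed
  have s_le: "s j \<le> xs ! j" if "j < m" for j
  proof -
    have "j mod r + s j * r = j" by (simp add: s_def)
    then show ?thesis using gap[of "j mod r" "s j"] that by simp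
  qed
  show ?thesis
  proof (rule that[of s "\<lambda>j. xs ! j - s j" m])
    show "\<nu> = exponents (\<lambda>j. s j + (xs ! j - s j)) {..<m}"
      unfolding xs(2) exponents_def m_def[symmetric] using s_le by (intro sum.cong) auto
    fix i j assume ij: "i < j" "j < m" "i mod (n - 1) = j mod (n - 1)"
    have "s i \<noteq> s j"
      using ij by (metis div_mult_mod_eq less_irrefl r_def s_def)
    then have "s i < s j" using ij by (simp add: s_def div_le_mono order_less_le)
    moreover have "xs ! i + 2 * (s j - s i) \<le> xs ! j" using gap' ij by (simp add: r_def)
    moreover have "s i \<le> xs ! i" "s j \<le> xs ! j" using s_le ij by auto
    ultimately show "s i < s j \<and> xs ! i - s i < xs ! j - s j" by linarith
  qed
qed

text \<open>Of the monomials with nonzero coefficient choose one with minimal Q. Its functional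
  vanishes on all the others by triangularity, and on the whole sum because that lies in the
  ideal.\<close>

lemma gordon_mons_independent:
  fixes c :: "_ \<Rightarrow> 'k::field_char_0"
  assumes "n \<ge> 2" "finite S" "S \<subseteq> gordon_mons n n 0"
    and "(\<Sum>\<mu>\<in>S. Poly_Mapping.single \<mu> (c \<mu>)) \<in> arc_ideal n"
  shows "\<forall>\<mu>\<in>S. c \<mu> = 0"
proof (rule ccontr)
  let ?Q = "mon_sum (\<lambda>i. i\<^sup>2)"
  assume "\<not> (\<forall>\<mu>\<in>S. c \<mu> = 0)"
  then obtain \<mu> where \<mu>: "\<mu> \<in> S" "c \<mu> \<noteq> 0" and min: "\<And>\<nu>. \<nu> \<in> S \<Longrightarrow> c \<nu> \<noteq> 0 \<Longrightarrow> ?Q \<mu> \<le> ?Q \<nu>"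
    using ex_has_least_nat[of "\<lambda>\<mu>. \<mu> \<in> S \<and> c \<mu> \<noteq> 0" _ ?Q] by blast
  obtain m s t where st: "\<mu> = exponents (\<lambda>j. s j + t j) {..<m}"
      "\<And>i j. i < j \<Longrightarrow> j < m \<Longrightarrow> i mod (n - 1) = j mod (n - 1) \<Longrightarrow> s i < s j \<and> t i < t j"
    using gordon_mons_split[of \<mu> n] \<mu> assms by blast
  let ?L = "det_functional m (n - 1) s t :: 'k arc_poly \<Rightarrow> 'k"
  have "?L (Poly_Mapping.single \<nu> (c \<nu>)) = (if \<nu> = \<mu> then of_nat (fact_prod \<mu>) * c \<mu> else 0)" if "\<nu> \<in> S" for \<nu>
  proof (cases "c \<nu> = 0 \<or> \<nu> = \<mu>")
    case True
    then show ?thesis using det_functional_single(1)[of m "n - 1" s t \<mu>, OF st(2,1)] \<mu>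
      by (auto simp: det_functional_def)
  next
    case False
    then show ?thesis using det_functional_single(2)[where r = "n - 1" and c = "c \<nu>", OF st(2,1)] min[OF that] by auto
  qed
  then have "?L (\<Sum>\<nu>\<in>S. Poly_Mapping.single \<nu> (c \<nu>)) = of_nat (fact_prod \<mu>) * c \<mu>"
    using assms(2) \<mu> by (simp add: det_functional_sum)
  moreover have "?L (\<Sum>\<nu>\<in>S. Poly_Mapping.single \<nu> (c \<nu>)) = 0"
    using assms by (intro det_functional_arc_ideal) auto
  moreover have "fact_prod \<mu> \<noteq> 0" by (simp add: fact_prod_def)
  ultimately show False using \<mu>(2) by simp
qed

section \<open>Reduction to standard monomials\<close>

lemma keys_arc_eqn:
  assumes "\<kappa> \<in> Poly_Mapping.keys (arc_eqn n l :: 'k::comm_ring_1 arc_poly)"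
  shows "mon_sum (\<lambda>_. 1) \<kappa> = n \<and> arc_weight \<kappa> = l"
proof -
  have "\<forall>\<kappa>\<in>Poly_Mapping.keys ((generic_arc ^ n :: 'k arc_poly fps) $ l). mon_sum (\<lambda>_. 1) \<kappa> = n \<and> mon_sum Suc \<kappa> = l"
  proof (induction n arbitrary: l)
    case (Suc n)
    have "Poly_Mapping.keys ((generic_arc ^ Suc n :: 'k arc_poly fps) $ l)
        \<subseteq> (\<Union>i\<in>{0..l}. Poly_Mapping.keys (generic_arc $ i * (generic_arc ^ n) $ (l - i) :: 'k arc_poly))"
      by (simp only: power_Suc fps_mult_nth) (rule keys_sum)
    moreover have "mon_sum (\<lambda>_. 1) \<kappa> = Suc n \<and> mon_sum Suc \<kappa> = l"
      if i: "i \<le> l" and \<kappa>: "\<kappa> \<in> Poly_Mapping.keys (generic_arc $ i * (generic_arc ^ n) $ (l - i) :: 'k arc_poly)" for i \<kappa>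
    proof -
      obtain a b where "\<kappa> = a + b" "a \<in> Poly_Mapping.keys (generic_arc $ i :: 'k arc_poly)"
        "b \<in> Poly_Mapping.keys ((generic_arc ^ n :: 'k arc_poly fps) $ (l - i))"
        using \<kappa> keys_mult by blast
      then show ?thesis
        using Suc.IH[of "l - i"] i by (auto simp: generic_arc_def arc_var_def split: if_splits)
    qed
    ultimately show ?case by fastforce
  qed auto
  then show ?thesis
    using assms by (simp add: arc_eqn_def arc_weight_eq_mon_sum)
qed

text \<open>The pairing of the equation with this monomial counts the n! orders of removing its n
  factors, which is nonzero in characteristic 0.\<close>

lemma lookup_arc_eqn_exponents:
  assumes "finite J" "card J = n" "(\<Sum>j\<in>J. Suc (d j)) = l"
  shows "Poly_Mapping.lookup (arc_eqn n l :: 'k::field_char_0 arc_poly) (exponents d J) \<noteq> 0"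
proof -
  have "pairing d J ((generic_arc ^ n :: 'k arc_poly fps) $ l) = fact n"
    using assms
  proof (induction n arbitrary: J l)
    case 0
    then show ?case by (simp add: pairing_def exponents_def fact_prod_def)
  next
    case (Suc n)
    have "pairing d J ((generic_arc ^ Suc n :: 'k arc_poly fps) $ l * 1) =
        (\<Sum>j | j \<in> J \<and> Suc (d j) \<le> l. pairing d (J - {j}) ((generic_arc ^ n) $ (l - Suc (d j)) * 1))"
      using Suc.prems(1) by (rule pairing_power_Suc)
    also have "\<dots> = (\<Sum>j\<in>J. fact n)"
    proof (rule sum.cong)
      have rm: "(\<Sum>i\<in>J. Suc (d i)) = Suc (d j) + (\<Sum>i\<in>J - {j}. Suc (d i))" if "j \<in> J" for j
        using Suc.prems(1) that by (rule sum.remove)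
      show "{j. j \<in> J \<and> Suc (d j) \<le> l} = J"
        using rm Suc.prems(3) by fastforce
      show "pairing d (J - {j}) ((generic_arc ^ n) $ (l - Suc (d j)) * 1) = (fact n :: 'k)" if "j \<in> J" for j
        using Suc.IH[of "J - {j}" "l - Suc (d j)"] Suc.prems rm[OF that] that by simp
    qed
    also have "\<dots> = fact (Suc n)"
      using Suc.prems by simp
    finally show ?case by simp
  qed
  then show ?thesis
    by (auto simp: pairing_def arc_eqn_def)
qed

text \<open>Weight and degree being fixed, \<open>\<Sum>\<^sub>x \<kappa>\<^sub>x x\<^sup>2\<close> differs by a constant from
  \<open>\<Sum>\<^sub>x \<kappa>\<^sub>x (x - i) (x - i - 1)\<close>, which is nonnegative and vanishes only on the variables \<open>i\<close> and \<open>i + 1\<close>.\<close>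

lemma mon_sum_square_balanced:
  fixes i a b :: nat
  defines "\<beta> \<equiv> Poly_Mapping.single i a + Poly_Mapping.single (Suc i) b"
  assumes deg: "mon_sum (\<lambda>_. 1) \<kappa> = mon_sum (\<lambda>_. 1) \<beta>" and wt: "arc_weight \<kappa> = arc_weight \<beta>"
    and ne: "\<kappa> \<noteq> \<beta>"
  shows "mon_sum (\<lambda>x. x\<^sup>2) \<beta> < mon_sum (\<lambda>x. x\<^sup>2) \<kappa>"
proof -
  let ?K = "Poly_Mapping.keys \<kappa>"
  let ?l = "Poly_Mapping.lookup \<kappa>"
  have lin: "mon_sum (\<lambda>x. f x + c * g x) \<nu> = mon_sum f \<nu> + c * mon_sum g \<nu>" for f g c \<nu>
    by (simp add: mon_sum_def distrib_right sum.distrib sum_distrib_left mult.assoc)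
  have Suc_eq: "mon_sum Suc \<nu> = mon_sum (\<lambda>x. x) \<nu> + mon_sum (\<lambda>_. 1) \<nu>" for \<nu>
    by (simp add: mon_sum_def sum.distrib add.commute)
  then have wt': "mon_sum (\<lambda>x. x) \<kappa> = mon_sum (\<lambda>x. x) \<beta>"
    using deg wt by (simp add: arc_weight_eq_mon_sum)
  \<comment> \<open>This is (x - i) (x - i - 1) >= 0, rearranged to avoid subtraction of natural
    numbers.\<close>
  have le: "(2 * i + 1) * x \<le> x\<^sup>2 + i * (i + 1)" for x
  proof (cases "x \<le> i")
    case True
    then obtain y where "i = x + y" using le_Suc_ex by blast
    then show ?thesis by (simp add: power2_eq_square algebra_simps)
  next
    case False
    then obtain y where "x = i + 1 + y" using le_Suc_ex[of "i + 1" x] by auto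
    then show ?thesis by (simp add: power2_eq_square algebra_simps)
  qed
  have less: "(2 * i + 1) * x < x\<^sup>2 + i * (i + 1)" if ne_x: "x \<noteq> i" "x \<noteq> Suc i" for x
  proof (cases "x \<le> i")
    case True
    then obtain y where "i = x + Suc y" using ne_x less_imp_Suc_add[of x i] by auto
    then show ?thesis by (simp add: power2_eq_square algebra_simps)
  next
    case False
    then obtain y where "x = Suc i + Suc y" using ne_x less_imp_Suc_add[of "Suc i" x] by auto
    then show ?thesis by (simp add: power2_eq_square algebra_simps)
  qed
  \<comment> \<open>On two adjacent variables, degree and weight determine both exponents.\<close>
  have "?K \<subseteq> {i, Suc i} \<Longrightarrow> \<kappa> = \<beta>"
  proof -
    assume K: "?K \<subseteq> {i, Suc i}"
    have eq: "mon_sum f \<kappa> = f i * ?l i + f (Suc i) * ?l (Suc i)" for f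
      using K by (subst mon_sum_superset[of "{i, Suc i}"]) auto
    have 1: "?l i + ?l (Suc i) = a + b"
      using deg by (simp add: eq \<beta>_def)
    have 2: "i * ?l i + Suc i * ?l (Suc i) = i * a + Suc i * b"
      using wt' by (simp add: eq \<beta>_def)
    have "i * (?l i + ?l (Suc i)) + ?l (Suc i) = i * (a + b) + b"
      using 2 by (simp add: algebra_simps)
    then have "?l (Suc i) = b" "?l i = a" using 1 by simp_all
    moreover have "?l x = 0" if "x \<noteq> i" "x \<noteq> Suc i" for x
      using K that by (auto simp: in_keys_iff)
    ultimately show "\<kappa> = \<beta>"
      by (intro poly_mapping_eqI) (auto simp: \<beta>_def lookup_add lookup_single when_def)
  qed
  then obtain x where x: "x \<in> ?K" "x \<noteq> i" "x \<noteq> Suc i" using ne by blast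
  have "mon_sum (\<lambda>x. (2 * i + 1) * x) \<kappa> < mon_sum (\<lambda>x. x\<^sup>2 + i * (i + 1)) \<kappa>"
    unfolding mon_sum_def
  proof (rule sum_strict_mono_ex1)
    show "\<forall>x\<in>?K. (2 * i + 1) * x * ?l x \<le> (x\<^sup>2 + i * (i + 1)) * ?l x"
      using le by (intro ballI mult_le_mono1)
    show "\<exists>x\<in>?K. (2 * i + 1) * x * ?l x < (x\<^sup>2 + i * (i + 1)) * ?l x"
      using less[OF x(2,3)] x(1) by (intro bexI[of _ x]) (simp_all add: in_keys_iff del: add_mult_distrib)
  qed simp
  moreover have "mon_sum (\<lambda>x. (2 * i + 1) * x) \<nu> = (2 * i + 1) * mon_sum (\<lambda>x. x) \<nu>" for \<nu>
    by (simp only: mon_sum_def sum_distrib_left mult.assoc)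
  moreover have "mon_sum (\<lambda>x. x\<^sup>2 + i * (i + 1)) \<nu> = mon_sum (\<lambda>x. x\<^sup>2) \<nu> + i * (i + 1) * mon_sum (\<lambda>_. 1) \<nu>" for \<nu>
    using lin[of "\<lambda>x. x\<^sup>2" "i * (i + 1)" "\<lambda>_. 1" \<nu>] by simp
  ultimately have "(2 * i + 1) * mon_sum (\<lambda>x. x) \<beta> <
      mon_sum (\<lambda>x. x\<^sup>2) \<kappa> + i * (i + 1) * mon_sum (\<lambda>_. 1) \<beta>"
    by (simp only: wt' deg)
  moreover have "(2 * i + 1) * mon_sum (\<lambda>x. x) \<beta> = mon_sum (\<lambda>x. x\<^sup>2) \<beta> + i * (i + 1) * mon_sum (\<lambda>_. 1) \<beta>"
    by (simp add: \<beta>_def algebra_simps power2_eq_square)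
  ultimately show ?thesis by linarith
qed


lemma exists_arc_eqn_lead:
  fixes i a b :: nat
  defines "\<beta> \<equiv> Poly_Mapping.single i a + Poly_Mapping.single (Suc i) b"
  shows "Poly_Mapping.lookup (arc_eqn (a + b) (arc_weight \<beta>) :: 'k::field_char_0 arc_poly) \<beta> \<noteq> 0"
proof -
  \<comment> \<open>Lists i exactly a times and Suc i exactly b times, which presents
    \<open>\<beta>\<close> as a family of a + b factors.\<close>
  define d where "d j = (if j < a then i else Suc i)" for j
  have const: "(\<Sum>j\<in>J. Poly_Mapping.single x (1 :: nat)) = Poly_Mapping.single x (card J)" for J :: "nat set" and x :: nat
    by (induction J rule: infinite_finite_induct) (simp_all del: sum_constant flip: single_add)
  have "exponents d {..<a + b} = exponents d {..<a} + exponents d {a..<a + b}"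
    unfolding exponents_def by (subst sum.union_disjoint[symmetric]) (auto intro: sum.cong)
  also have "exponents d {..<a} = (\<Sum>j<a. Poly_Mapping.single i 1)"
    unfolding exponents_def by (intro sum.cong) (auto simp: d_def)
  also have "exponents d {a..<a + b} = (\<Sum>j\<in>{a..<a + b}. Poly_Mapping.single (Suc i) 1)"
    unfolding exponents_def by (intro sum.cong) (auto simp: d_def)
  also have "(\<Sum>j<a. Poly_Mapping.single i 1) + (\<Sum>j\<in>{a..<a + b}. Poly_Mapping.single (Suc i) 1) = \<beta>"
    unfolding const \<beta>_def by simp
  finally have \<beta>: "exponents d {..<a + b} = \<beta>" .
  have "(\<Sum>j<a + b. Suc (d j)) = arc_weight \<beta>"
    unfolding \<beta>[symmetric] arc_weight_eq_mon_sum by (simp add: exponents_def mon_sum_sum)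
  then show ?thesis
    using lookup_arc_eqn_exponents[of "{..<a + b}" "a + b" d] by (simp add: \<beta>)
qed

lemma poly_eq_sum_single: "p = (\<Sum>m\<in>Poly_Mapping.keys p. Poly_Mapping.single m (Poly_Mapping.lookup p m))"
  by (rule poly_mapping_eqI) (auto simp: lookup_sum lookup_single when_def in_keys_iff)

section \<open>Rewriting modulo the arc ideal\<close>

definition reducible_to :: "nat \<Rightarrow> (nat \<Rightarrow>\<^sub>0 nat) set \<Rightarrow> 'k::comm_ring_1 arc_poly set"
  where "reducible_to n B = {p. \<exists>c. p - (\<Sum>\<mu>\<in>B. Poly_Mapping.single \<mu> (c \<mu>)) \<in> arc_ideal n}"

lemma reducible_to_ideal: "p \<in> arc_ideal n \<Longrightarrow> p \<in> reducible_to n B"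
  unfolding reducible_to_def by (auto intro!: exI[of _ "\<lambda>_. 0"])

lemma reducible_to_add:
  assumes "p \<in> reducible_to n B" "q \<in> reducible_to n B"
  shows "p + q \<in> reducible_to n B"
proof -
  obtain c d where "p - (\<Sum>\<mu>\<in>B. Poly_Mapping.single \<mu> (c \<mu>)) \<in> arc_ideal n"
      "q - (\<Sum>\<mu>\<in>B. Poly_Mapping.single \<mu> (d \<mu>)) \<in> arc_ideal n"
    using assms by (auto simp: reducible_to_def)
  from arc_ideal_closed(2)[OF this] have "p + q - (\<Sum>\<mu>\<in>B. Poly_Mapping.single \<mu> (c \<mu> + d \<mu>)) \<in> arc_ideal n"
    by (simp add: single_add sum.distrib algebra_simps)
  then show ?thesis unfolding reducible_to_def by (intro CollectI exI[of _ "\<lambda>\<mu>. c \<mu> + d \<mu>"])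
qed

lemma reducible_to_smult:
  assumes "p \<in> reducible_to n B"
  shows "Poly_Mapping.single 0 a * p \<in> reducible_to n B"
proof -
  obtain c where "p - (\<Sum>\<mu>\<in>B. Poly_Mapping.single \<mu> (c \<mu>)) \<in> arc_ideal n"
    using assms by (auto simp: reducible_to_def)
  from arc_ideal_closed(3)[OF this, of "Poly_Mapping.single 0 a"]
  have "Poly_Mapping.single 0 a * p - (\<Sum>\<mu>\<in>B. Poly_Mapping.single \<mu> (a * c \<mu>)) \<in> arc_ideal n"
    by (simp add: right_diff_distrib sum_distrib_left mult_single)
  then show ?thesis unfolding reducible_to_def by (intro CollectI exI[of _ "\<lambda>\<mu>. a * c \<mu>"])
qed

lemma reducible_to_single:
  assumes "finite B" "\<mu> \<in> B"
  shows "(Poly_Mapping.single \<mu> 1 :: 'k::comm_ring_1 arc_poly) \<in> reducible_to n B"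
proof -
  have "(\<Sum>\<nu>\<in>B. Poly_Mapping.single \<nu> (if \<nu> = \<mu> then 1 else 0)) =
      (\<Sum>\<nu>\<in>B. if \<nu> = \<mu> then Poly_Mapping.single \<mu> 1 else (0 :: 'k arc_poly))"
    by (intro sum.cong) auto
  also have "\<dots> = Poly_Mapping.single \<mu> 1"
    using assms by simp
  finally show ?thesis
    unfolding reducible_to_def
    by (intro CollectI exI[of _ "\<lambda>\<nu>. if \<nu> = \<mu> then 1 else 0"]) (simp add: arc_ideal_closed(1))
qed

lemma reducible_to_sum:
  "(\<And>i. i \<in> A \<Longrightarrow> f i \<in> reducible_to n B) \<Longrightarrow> (\<Sum>i\<in>A. f i) \<in> reducible_to n B"
  by (induction A rule: infinite_finite_induct)
    (auto intro: reducible_to_add reducible_to_ideal arc_ideal_closed(1))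

text \<open>A nonstandard monomial is divisible by a balanced \<open>\<beta>\<close> of degree n.
  Solving the corresponding multiple of an equation for it leaves monomials of the same weight with
  larger Q. Since Q is bounded on the finitely many monomials of weight w, \<open>M - ?Q\<close> is
  a terminating measure.\<close>

lemma monomial_reducible:
  fixes n w :: nat
  assumes "n \<ge> 1"
  defines "B \<equiv> {\<mu> \<in> gordon_mons n n 0. arc_weight \<mu> = w}"
  shows "arc_weight \<nu> = w \<Longrightarrow> (Poly_Mapping.single \<nu> 1 :: 'k::field_char_0 arc_poly) \<in> reducible_to n B"
proof -
  let ?Q = "mon_sum (\<lambda>x. x\<^sup>2)"
  define M where "M = Max (?Q ` {\<kappa>. arc_weight \<kappa> = w})"
  have M: "?Q \<kappa> \<le> M" if "arc_weight \<kappa> = w" for \<kappa>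
    unfolding M_def using that finite_arc_weight[of w] by (intro Max_ge) auto
  have finB: "finite B"
    unfolding B_def by (rule finite_subset[OF _ finite_arc_weight[of w]]) auto
  show "(Poly_Mapping.single \<nu> 1 :: 'k arc_poly) \<in> reducible_to n B" if "arc_weight \<nu> = w"
    using that
  proof (induction \<nu> rule: measure_induct_rule[of "\<lambda>\<nu>. M - ?Q \<nu>"])
    case (less \<nu>)
    show ?case
    proof (cases "\<nu> \<in> gordon_mons n n 0")
      case True
      then show ?thesis using less.prems finB by (intro reducible_to_single) (simp_all add: B_def)
    next
      case False
      then have "\<not> (Poly_Mapping.lookup \<nu> 0 < n \<and>
          (\<forall>x. Poly_Mapping.lookup \<nu> x + Poly_Mapping.lookup \<nu> (Suc x) < n))"
        by (simp add: gordon_mons_def)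
      then obtain i where i: "Poly_Mapping.lookup \<nu> i + Poly_Mapping.lookup \<nu> (Suc i) \<ge> n"
        by (metis add_lessD1 not_le)
      \<comment> \<open>Takes as much of the variable i as possible and fills up with its successor
        to degree exactly n.\<close>
      define a b where "a = min (Poly_Mapping.lookup \<nu> i) n" and "b = n - a"
      define \<beta> where "\<beta> = Poly_Mapping.single i a + Poly_Mapping.single (Suc i) b"
      define u where "u = \<nu> - \<beta>"
      have n: "a + b = n" by (simp add: a_def b_def)
      have ab: "a \<le> Poly_Mapping.lookup \<nu> i" "b \<le> Poly_Mapping.lookup \<nu> (Suc i)"
        using i by (auto simp: a_def b_def)
      have \<nu>: "\<nu> = u + \<beta>"
        using ab by (intro poly_mapping_eqI)
          (auto simp: u_def \<beta>_def lookup_add lookup_minus lookup_single when_def)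
      define f :: "'k arc_poly" where "f = arc_eqn n (arc_weight \<beta>)"
      have lead: "Poly_Mapping.lookup f \<beta> \<noteq> 0"
        using exists_arc_eqn_lead[of a b i, where 'k = 'k] by (simp add: f_def n \<beta>_def)
      have deg: "mon_sum (\<lambda>_. 1) \<beta> = n" using n by (simp add: \<beta>_def)
      have "arc_weight \<beta> \<ge> 1"
        using assms(1) n by (simp add: arc_weight_eq_mon_sum \<beta>_def)
      then have f_in: "Poly_Mapping.single u 1 * f \<in> arc_ideal n"
        unfolding f_def by (intro arc_ideal_closed)
      have "f = (\<Sum>\<kappa>\<in>Poly_Mapping.keys f. Poly_Mapping.single \<kappa> (Poly_Mapping.lookup f \<kappa>))"
        by (rule poly_eq_sum_single)
      also have "\<dots> = Poly_Mapping.single \<beta> (Poly_Mapping.lookup f \<beta>) +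
          (\<Sum>\<kappa>\<in>Poly_Mapping.keys f - {\<beta>}. Poly_Mapping.single \<kappa> (Poly_Mapping.lookup f \<kappa>))"
        using lead by (intro sum.remove) (auto simp: in_keys_iff)
      finally have "Poly_Mapping.single u 1 * f = Poly_Mapping.single u 1 * (Poly_Mapping.single \<beta> (Poly_Mapping.lookup f \<beta>) +
          (\<Sum>\<kappa>\<in>Poly_Mapping.keys f - {\<beta>}. Poly_Mapping.single \<kappa> (Poly_Mapping.lookup f \<kappa>)))"
        by (rule arg_cong)
      then have "Poly_Mapping.single u 1 * f = Poly_Mapping.single \<nu> (Poly_Mapping.lookup f \<beta>) +
          (\<Sum>\<kappa>\<in>Poly_Mapping.keys f - {\<beta>}. Poly_Mapping.single (u + \<kappa>) (Poly_Mapping.lookup f \<kappa>))"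
        by (simp add: \<nu> distrib_left sum_distrib_left mult_single)
      then have eq: "Poly_Mapping.single \<nu> (Poly_Mapping.lookup f \<beta>) = Poly_Mapping.single u 1 * f +
          (\<Sum>\<kappa>\<in>Poly_Mapping.keys f - {\<beta>}. Poly_Mapping.single 0 (- Poly_Mapping.lookup f \<kappa>) * Poly_Mapping.single (u + \<kappa>) 1)"
        by (simp add: mult_single single_uminus sum_negf)
      have "Poly_Mapping.single \<nu> (Poly_Mapping.lookup f \<beta>) \<in> reducible_to n B"
        unfolding eq
      proof (rule reducible_to_add[OF reducible_to_ideal[OF f_in] reducible_to_sum[OF reducible_to_smult]])
        fix \<kappa> assume \<kappa>: "\<kappa> \<in> Poly_Mapping.keys f - {\<beta>}"
        then have k: "mon_sum (\<lambda>_. 1) \<kappa> = n" "arc_weight \<kappa> = arc_weight \<beta>"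
          using keys_arc_eqn[of \<kappa> n "arc_weight \<beta>", where 'k = 'k] by (auto simp: f_def)
        have "?Q \<beta> < ?Q \<kappa>"
          unfolding \<beta>_def using \<kappa> k deg by (intro mon_sum_square_balanced) (simp_all add: \<beta>_def)
        moreover have wt: "arc_weight (u + \<kappa>) = w"
          using k(2) less.prems by (simp add: \<nu> arc_weight_eq_mon_sum)
        ultimately have "M - ?Q (u + \<kappa>) < M - ?Q \<nu>"
          using M[OF wt] by (simp add: \<nu>)
        then show "(Poly_Mapping.single (u + \<kappa>) 1 :: 'k arc_poly) \<in> reducible_to n B"
          using less.IH wt by blast
      qed
      \<comment> \<open>The coefficient of \<open>\<beta>\<close> is nonzero in a field and can be
        divided out.\<close>
      from reducible_to_smult[OF this, of "1 / Poly_Mapping.lookup f \<beta>"] show ?thesis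
        using lead by (simp add: mult_single)
    qed
  qed
qed

lemma weight_piece_reducible:
  fixes p :: "'k::field_char_0 arc_poly"
  assumes "n \<ge> 1" "p \<in> weight_piece w"
  shows "p \<in> reducible_to n {\<mu> \<in> gordon_mons n n 0. arc_weight \<mu> = w}"
proof -
  have "(\<Sum>m\<in>Poly_Mapping.keys p. Poly_Mapping.single 0 (Poly_Mapping.lookup p m) * Poly_Mapping.single m 1)
      \<in> reducible_to n {\<mu> \<in> gordon_mons n n 0. arc_weight \<mu> = w}"
    using assms by (intro reducible_to_sum reducible_to_smult monomial_reducible) (auto simp: weight_piece_def)
  then show ?thesis
    using poly_eq_sum_single[of p] by (simp add: mult_single)
qed

section \<open>Dimensions of the graded pieces\<close>

lemma arc_class_add: "arc_class n (p + q) = arc_class n p \<oplus>\<^bsub>focussed_arc_algebra n\<^esub> arc_class n q"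
  and arc_class_mult: "arc_class n (p * q) = arc_class n p \<otimes>\<^bsub>focussed_arc_algebra n\<^esub> arc_class n q"
  and arc_class_0: "arc_class n (0 :: 'k arc_poly) = \<zero>\<^bsub>focussed_arc_algebra n\<^esub>"
  and arc_class_carrier: "arc_class n p \<in> carrier (focussed_arc_algebra n)"
  for p q :: "'k::comm_ring_1 arc_poly"
proof -
  interpret h: ring_hom_ring "ring_of_type_algebra :: 'k arc_poly ring" "focussed_arc_algebra n" "arc_class n"
    by (rule arc_class_ring_hom)
  show "arc_class n (p + q) = arc_class n p \<oplus>\<^bsub>focussed_arc_algebra n\<^esub> arc_class n q"
    using h.hom_add[of p q] by (simp add: ring_of_type_algebra_def)
  show "arc_class n (p * q) = arc_class n p \<otimes>\<^bsub>focussed_arc_algebra n\<^esub> arc_class n q"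
    using h.hom_mult[of p q] by (simp add: ring_of_type_algebra_def)
  show "arc_class n (0 :: 'k arc_poly) = \<zero>\<^bsub>focussed_arc_algebra n\<^esub>"
    using h.hom_zero by (simp add: ring_of_type_algebra_def)
  show "arc_class n p \<in> carrier (focussed_arc_algebra n)"
    using h.hom_closed[of p] by (simp add: ring_of_type_algebra_def)
qed

lemma arc_class_eq_iff: "arc_class n p = arc_class n q \<longleftrightarrow> p - q \<in> arc_ideal n"
  for p q :: "'k::comm_ring_1 arc_poly"
proof -
  interpret I: ideal "arc_ideal n" "ring_of_type_algebra :: 'k arc_poly ring" by (rule ideal_arc_ideal)
  interpret h: ring_hom_ring "ring_of_type_algebra :: 'k arc_poly ring" "focussed_arc_algebra n" "arc_class n"
    by (rule arc_class_ring_hom)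
  have zero: "r \<in> arc_ideal n \<longleftrightarrow> arc_class n r = \<zero>\<^bsub>focussed_arc_algebra n\<^esub>" for r :: "'k arc_poly"
  proof -
    have "\<zero>\<^bsub>focussed_arc_algebra n\<^esub> = (arc_ideal n :: 'k arc_poly set)"
      by (simp add: focussed_arc_algebra_def FactRing_def)
    then show ?thesis
      using I.a_rcos_const[of r] I.a_rcos_self[of r]
      by (auto simp: arc_class_def ring_of_type_algebra_def)
  qed
  have "arc_class n p = arc_class n (p - q) \<oplus>\<^bsub>focussed_arc_algebra n\<^esub> arc_class n q"
    by (simp flip: arc_class_add)
  moreover have "arc_class n (p - q) \<oplus>\<^bsub>focussed_arc_algebra n\<^esub> arc_class n q = arc_class n q \<longleftrightarrow>
      arc_class n (p - q) = \<zero>\<^bsub>focussed_arc_algebra n\<^esub>"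
    using arc_class_carrier by (metis h.S.add.l_cancel_one h.S.add.m_comm)
  ultimately show ?thesis by (simp only: zero)
qed

text \<open>\<open>Span\<close> is built by successive line extensions, hence the induction on the
  list. Distinctness allows the coefficient at the new head to be chosen without disturbing the
  others.\<close>

lemma Span_monomial_classes:
  assumes "distinct ms"
  shows "ring.Span (focussed_arc_algebra n :: 'k::field arc_poly set ring) (arc_scalars n)
      (map (\<lambda>m. arc_class n (Poly_Mapping.single m 1)) ms) =
    {arc_class n (\<Sum>m\<in>set ms. Poly_Mapping.single m (c m)) | c. True}"
proof -
  interpret h: ring_hom_ring "ring_of_type_algebra :: 'k arc_poly ring" "focussed_arc_algebra n" "arc_class n"
    by (rule arc_class_ring_hom)
  let ?S = "\<lambda>ms c. \<Sum>m\<in>set ms. Poly_Mapping.single m (c m :: 'k)"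
  show ?thesis
    using assms
  proof (induction ms)
    case Nil
    show ?case by (simp add: arc_class_0)
  next
    case (Cons m ms)
    have scal: "arc_class n (arc_const a) \<otimes>\<^bsub>focussed_arc_algebra n\<^esub> arc_class n (Poly_Mapping.single m 1) =
        arc_class n (Poly_Mapping.single m (a :: 'k))" for a
      by (simp add: arc_const_def mult_single flip: arc_class_mult)
    have split: "arc_class n (Poly_Mapping.single m a + ?S ms c) = arc_class n (arc_const a)
        \<otimes>\<^bsub>focussed_arc_algebra n\<^esub> arc_class n (Poly_Mapping.single m 1)
        \<oplus>\<^bsub>focussed_arc_algebra n\<^esub> arc_class n (?S ms c)" for a c
      by (simp only: arc_class_add scal)
    have ext: "h.S.Span (arc_scalars n) (map (\<lambda>m. arc_class n (Poly_Mapping.single m 1)) (m # ms)) =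
        h.S.line_extension (arc_scalars n) (arc_class n (Poly_Mapping.single m 1))
          {arc_class n (?S ms c) | c. True}"
      using Cons by simp
    have mem: "x \<in> h.S.Span (arc_scalars n) (map (\<lambda>m. arc_class n (Poly_Mapping.single m 1)) (m # ms)) \<longleftrightarrow>
        (\<exists>a c. x = arc_class n (Poly_Mapping.single m a + ?S ms c))" for x
      unfolding ext h.S.line_extension_mem_iff split unfolding arc_scalars_def by blast
    have merge: "(\<exists>a c. x = arc_class n (Poly_Mapping.single m a + ?S ms c)) \<longleftrightarrow>
        (\<exists>c. x = arc_class n (?S (m # ms) c))" for x
    proof
      assume "\<exists>c. x = arc_class n (?S (m # ms) c)"
      then obtain c where "x = arc_class n (?S (m # ms) c)" by blast
      then have "x = arc_class n (Poly_Mapping.single m (c m) + ?S ms c)"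
        using Cons.prems by simp
      then show "\<exists>a c. x = arc_class n (Poly_Mapping.single m a + ?S ms c)" by blast
    next
      assume "\<exists>a c. x = arc_class n (Poly_Mapping.single m a + ?S ms c)"
      then obtain a c where x: "x = arc_class n (Poly_Mapping.single m a + ?S ms c)" by blast
      have "?S ms (c(m := a)) = ?S ms c"
        using Cons.prems by (intro sum.cong) auto
      then have "x = arc_class n (?S (m # ms) (c(m := a)))"
        using Cons.prems x by simp
      then show "\<exists>c. x = arc_class n (?S (m # ms) c)" by blast
    qed
    show ?case
      by (rule Set.set_eqI) (simp only: mem merge mem_Collect_eq simp_thms)
  qed
qed

text \<open>The classes of the standard monomials of weight w form a basis: independence comes from
  the determinant functionals, spanning from the reduction.\<close>

lemma dim_arc_piece:
  assumes "n \<ge> 2"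
  shows "ring.dim (focussed_arc_algebra n :: 'k::field_char_0 arc_poly set ring) (arc_scalars n) (arc_piece n w)
    = card {\<mu> \<in> gordon_mons n n 0. arc_weight \<mu> = w}"
proof -
  let ?A = "focussed_arc_algebra n :: 'k arc_poly set ring"
  let ?c = "arc_class n :: 'k arc_poly \<Rightarrow> _"
  let ?B = "{\<mu> \<in> gordon_mons n n 0. arc_weight \<mu> = w}"
  interpret h: ring_hom_ring "ring_of_type_algebra :: 'k arc_poly ring" ?A ?c
    by (rule arc_class_ring_hom)
  have "finite ?B"
    by (rule finite_subset[OF _ finite_arc_weight[of w]]) auto
  then obtain ms where ms: "set ms = ?B" "distinct ms"
    using finite_distinct_list by blast
  let ?Us = "\<lambda>ms. map (\<lambda>m. ?c (Poly_Mapping.single m 1)) ms"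
  have "h.S.independent (arc_scalars n) (?Us ms')" if "distinct ms'" "set ms' \<subseteq> ?B" for ms'
    using that
  proof (induction ms')
    case (Cons m ms')
    have "?c (Poly_Mapping.single m 1) \<notin> h.S.Span (arc_scalars n) (?Us ms')"
    proof
      assume "?c (Poly_Mapping.single m 1) \<in> h.S.Span (arc_scalars n) (?Us ms')"
      then obtain c where "?c (Poly_Mapping.single m 1) = ?c (\<Sum>\<mu>\<in>set ms'. Poly_Mapping.single \<mu> (c \<mu>))"
        using Cons.prems Span_monomial_classes[of ms' n, where 'k = 'k] by auto
      then have "Poly_Mapping.single m 1 - (\<Sum>\<mu>\<in>set ms'. Poly_Mapping.single \<mu> (c \<mu>)) \<in> (arc_ideal n :: 'k arc_poly set)"
        by (simp only: arc_class_eq_iff)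
      \<comment> \<open>The difference is one linear combination of standard monomials with
        coefficient 1 at m, which contradicts independence.\<close>
      also have "Poly_Mapping.single m 1 - (\<Sum>\<mu>\<in>set ms'. Poly_Mapping.single \<mu> (c \<mu>)) =
          (\<Sum>\<mu>\<in>set (m # ms'). Poly_Mapping.single \<mu> (if \<mu> = m then 1 else - c \<mu>))"
      proof -
        have "(\<Sum>\<mu>\<in>set ms'. Poly_Mapping.single \<mu> (if \<mu> = m then 1 else - c \<mu>)) = (\<Sum>\<mu>\<in>set ms'. - Poly_Mapping.single \<mu> (c \<mu>))"
          using Cons.prems by (intro sum.cong) (auto simp: single_uminus)
        then show ?thesis using Cons.prems by (simp add: sum_negf)
      qed
      finally have "\<forall>\<mu>\<in>set (m # ms'). (if \<mu> = m then 1 else - c \<mu>) = 0"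
        using Cons.prems assms by (intro gordon_mons_independent) auto
      then show False by simp
    qed
    then show ?case
      using Cons by (simp add: h.S.independent.li_Cons arc_class_carrier del: h.S.Span.simps)
  qed simp
  then have "h.S.dimension (length (?Us ms)) (arc_scalars n) (h.S.Span (arc_scalars n) (?Us ms))"
    using ms by (intro h.S.dimension_independent) auto
  moreover have "h.S.Span (arc_scalars n) (?Us ms) = arc_piece n w"
  proof (intro subset_antisym subsetI)
    fix x assume "x \<in> h.S.Span (arc_scalars n) (?Us ms)"
    then obtain c where x: "x = ?c (\<Sum>\<mu>\<in>?B. Poly_Mapping.single \<mu> (c \<mu>))"
      using Span_monomial_classes[OF ms(2), of n, where 'k = 'k] ms(1) by auto
    have "(\<Sum>\<mu>\<in>?B. Poly_Mapping.single \<mu> (c \<mu>)) \<in> weight_piece w"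
      using keys_sum[of "\<lambda>\<mu>. Poly_Mapping.single \<mu> (c \<mu>)" ?B]
      by (fastforce simp: weight_piece_def split: if_splits)
    then show "x \<in> arc_piece n w" by (auto simp: arc_piece_def x)
  next
    fix x assume "x \<in> (arc_piece n w :: 'k arc_poly set set)"
    then obtain p where p: "x = ?c p" "p \<in> weight_piece w" by (auto simp: arc_piece_def)
    then obtain c where "p - (\<Sum>\<mu>\<in>?B. Poly_Mapping.single \<mu> (c \<mu>)) \<in> arc_ideal n"
      using weight_piece_reducible[of n p w] assms by (auto simp: reducible_to_def)
    then have "x = ?c (\<Sum>\<mu>\<in>?B. Poly_Mapping.single \<mu> (c \<mu>))"
      using p by (simp add: arc_class_eq_iff)
    then show "x \<in> h.S.Span (arc_scalars n) (?Us ms)"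
      using Span_monomial_classes[OF ms(2), of n, where 'k = 'k] ms(1) by auto
  qed
  ultimately have "h.S.dimension (card ?B) (arc_scalars n) (arc_piece n w)"
    using ms distinct_card by fastforce
  with subfield_arc_scalars[of n, where 'k = 'k] assms show ?thesis
    using h.S.dimI[of "arc_scalars n" "card ?B" "arc_piece n w"] by (simp add: over_def)
qed

theorem theorem5p6:
  fixes n :: nat
  assumes "n \<ge> 2"
  shows "hilbert_poincare (focussed_arc_algebra n :: 'k::field_char_0 arc_poly set ring)
             (arc_scalars n) (arc_piece n)
           = prodinf (\<lambda>i. if i \<ge> 1 then inv_one_minus_X_power i else 1) *
             prodinf (\<lambda>i. if i \<ge> 1 \<and> i mod (2 * n + 1) \<in> {0, n, n + 1} then 1 - fps_X ^ i else 1)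
       \<and> hilbert_poincare (focussed_arc_algebra n :: 'k::field_char_0 arc_poly set ring)
             (arc_scalars n) (arc_piece n)
           = prodinf (\<lambda>i. if i \<ge> 1 \<and> i mod (2 * n + 1) \<notin> {0, n, n + 1}
                   then inv_one_minus_X_power i else 1)"
proof -
  \<comment> \<open>Each coefficient is the number of standard monomials of that weight, so Gordon's
    identity supplies both product forms.\<close>
  have "hilbert_poincare (focussed_arc_algebra n :: 'k arc_poly set ring) (arc_scalars n) (arc_piece n)
      = gordon_fps n n 0"
    by (simp add: hilbert_poincare_def gordon_fps_def dim_arc_piece[OF assms])
  then show ?thesis
    using gordon_identity[of n] assms by simp
qed

end
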